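(* Let $\mu$ be a Borel measure on $\mathbb{R}$ with $\int_{\mathbb{R}}(1+|t|)^{-1}d\mu(t)<\infty$, $A=M_t$ on $L^2(\mu)$, $\varphi\equiv\mathbf 1$, and for $\beta\in\mathbb{R}$ let $A_\beta=A+\beta(\,\cdot\,,\varphi)\varphi$, with spectral measure $\mu_\beta$ corresponding to $\varphi$. For a finite Borel measure $\sigma$ on $\mathbb{R}$ define the averaged spectral measure $\tau=\int\mu_\beta\,d\sigma(\beta)$, and let $d\tau=w\,dt+d\tau_{\mathrm s}$ be its Lebesgue decomposition. Let $$E:=\Bigl\{\alpha\in\mathbb{R}:\ \int\frac{d\sigma(\beta)}{|\alpha-\beta|^2}<\infty\Bigr\}.$$ Let $I$ be a bounded closed interval (of positive length) such that the distribution function $D_w(y)=|\{x\in I:\ w(x)<y\}|$ satisfies $$\int_0^\delta\frac{1}{D_w(y)}\,dy=\infty$$ for some $\delta>0$. Then for all $\alpha\in E$ (in particular, for all $\alpha$ outside of the closed support of $\sigma$) the operator $A_\alpha$ has empty singular spectrum on $I$.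
   Context: $|\cdot|$ of a set is Lebesgue measure on $\mathbb{R}$, and $1/D_w(y)=+\infty$ where $D_w(y)=0$. $\tau(B)=\int\mu_\beta(B)\,d\sigma(\beta)$ for Borel sets $B$. $A=M_t$ is multiplication by the independent variable in the complex space $L^2(\mu)$, with maximal domain. (Every self-adjoint $A$ with a cyclic vector $\varphi\in\mathcal H_{-1}(A)$ is unitarily equivalent to this model, with $\mu$ the spectral measure corresponding to $\varphi$ and $\varphi$ represented by $\mathbf 1$.) The function $\mathbf 1$ need not lie in $L^2(\mu)$. For $\lambda\in\mathbb{C}\setminus\mathbb{R}$ put $F(\lambda)=\int\frac{d\mu(t)}{t-\lambda}$. For $\alpha\in\mathbb{R}$, $A_\alpha=A+\alpha(\cdot,\varphi)\varphi$ denotes the self-adjoint operator on $L^2(\mu)$ whose resolvent is $$(A_\alpha-\lambda)^{-1}f=(A-\lambda)^{-1}f-\frac{\alpha\,\int\frac{f(t)}{t-\lambda}d\mu(t)}{1+\alpha F(\lambda)}\cdot\frac{1}{t-\lambda},\qquad f\in L^2(\mu),\ \lambda\in\mathbb{C}\setminus\mathbb{R}$$ (the usual rank one perturbation if $\mathbf 1\in L^2(\mu)$). The formula is also used for $f=\varphi$, giving $(A_\alpha-\lambda)^{-1}\varphi=(1+\alpha F(\lambda))^{-1}(t-\lambda)^{-1}$; $\varphi$ is cyclic for $A_\alpha$. $\mu_\alpha$ is the spectral measure of $A_\alpha$ corresponding to $\varphi$: the unique Borel measure with $\int\frac{d\mu_\alpha(s)}{s-\lambda}=((A_\alpha-\lambda)^{-1}\varphi,\varphi)$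 for all $\lambda\in\mathbb{C}\setminus\mathbb{R}$. "$A_\alpha$ has empty singular spectrum on $I$" means that $\mu_\alpha$ has no singular part on $I$, i.e. $(\mu_\alpha)_{\mathrm s}(I)=0$, where $(\mu_\alpha)_{\mathrm s}$ is the part of $\mu_\alpha$ singular with respect to Lebesgue measure. *)

theory Defs
  imports "HOL-Analysis.Analysis"
begin

definition borel_transform :: "real measure \<Rightarrow> complex \<Rightarrow> complex" where
  "borel_transform \<mu> z = (LINT t|\<mu>. 1 / (of_real t - z))"

text \<open>
  The resolvent at \<open>z\<close> of the rank one perturbation \<open>A + \<alpha> (\<cdot>, \<phi>) \<phi>\<close>, where \<open>A\<close> is
  multiplication by the independent variable in the complex space \<open>L\<^sup>2(\<mu>)\<close> and \<open>\<phi> = 1\<close>. The perturbed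
  operator is by definition the one with this resolvent. The formula acts on representatives and
  also makes sense for \<open>f = 1\<close> when \<open>1\<close> is not in \<open>L\<^sup>2(\<mu>)\<close>, provided \<open>1 / (1 + \<bar>t\<bar>)\<close> is
  \<open>\<mu>\<close>-integrable.
\<close>

definition rank_one_resolvent ::
    "real measure \<Rightarrow> real \<Rightarrow> complex \<Rightarrow> (real \<Rightarrow> complex) \<Rightarrow> real \<Rightarrow> complex" where
  "rank_one_resolvent \<mu> \<alpha> z f = (\<lambda>t.
     f t / (of_real t - z)
     - (of_real \<alpha> * (LINT s|\<mu>. f s / (of_real s - z))) / (1 + of_real \<alpha> * borel_transform \<mu> z)
       * (1 / (of_real t - z)))"

definition L2_inner :: "real measure \<Rightarrow> (real \<Rightarrow> complex) \<Rightarrow> (real \<Rightarrow> complex) \<Rightarrow> complex" where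
  "L2_inner \<mu> f g = (LINT t|\<mu>. f t * cnj (g t))"

text \<open>
  \<open>\<nu>\<close> is the spectral measure, corresponding to \<open>\<phi> = 1\<close>, of the rank one perturbation with
  parameter \<open>\<alpha>\<close>. Stated as a predicate; \<open>\<nu>\<close> is uniquely determined by \<open>\<mu>\<close> and \<open>\<alpha>\<close>. Note that
  \<open>has_bochner_integral\<close> includes the absolute integrability of \<open>1 / (s - z)\<close>.
\<close>

definition is_spectral_measure :: "real measure \<Rightarrow> real \<Rightarrow> real measure \<Rightarrow> bool" where
  "is_spectral_measure \<mu> \<alpha> \<nu> \<longleftrightarrow>
     sets \<nu> = sets borel \<and>
     (\<forall>z. Im z \<noteq> 0 \<longrightarrow>
        has_bochner_integral \<nu> (\<lambda>s. 1 / (of_real s - z))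
          (L2_inner \<mu> (rank_one_resolvent \<mu> \<alpha> z (\<lambda>_. 1)) (\<lambda>_. 1)))"

definition averaged_measure :: "real measure \<Rightarrow> (real \<Rightarrow> real measure) \<Rightarrow> real measure" where
  "averaged_measure \<sigma> M = measure_of UNIV (sets borel) (\<lambda>B. \<integral>\<^sup>+ \<beta>. emeasure (M \<beta>) B \<partial>\<sigma>)"

definition lebesgue_decomposition ::
    "real measure \<Rightarrow> (real \<Rightarrow> real) \<Rightarrow> real measure \<Rightarrow> bool" where
  "lebesgue_decomposition \<nu> w \<nu>\<^sub>s \<longleftrightarrow>
     sets \<nu> = sets borel \<and> sets \<nu>\<^sub>s = sets borel \<and>
     w \<in> borel_measurable borel \<and> (\<forall>x. 0 \<le> w x) \<and>
     (\<exists>N\<in>null_sets lborel. emeasure \<nu>\<^sub>s (- N) = 0) \<and>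
     (\<forall>B\<in>sets borel. emeasure \<nu> B = (\<integral>\<^sup>+ x\<in>B. ennreal (w x) \<partial>lborel) + emeasure \<nu>\<^sub>s B)"

text \<open>The operator with spectral measure \<open>\<nu>\<close> has empty singular spectrum on \<open>I\<close>.\<close>

definition empty_singular_spectrum_on :: "real measure \<Rightarrow> real set \<Rightarrow> bool" where
  "empty_singular_spectrum_on \<nu> I \<longleftrightarrow>
     (\<exists>w \<nu>\<^sub>s. lebesgue_decomposition \<nu> w \<nu>\<^sub>s \<and> emeasure \<nu>\<^sub>s I = 0)"

text \<open>In \<^typ>\<open>ennreal\<close>, \<open>1 / 0 = \<infinity>\<close>, so an atom of \<open>\<sigma>\<close> at \<open>\<alpha>\<close> excludes \<open>\<alpha>\<close>.\<close>

definition finite_energy_set :: "real measure \<Rightarrow> real set" where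
  "finite_energy_set \<sigma> = {\<alpha>. (\<integral>\<^sup>+ \<beta>. 1 / ennreal (\<bar>\<alpha> - \<beta>\<bar>\<^sup>2) \<partial>\<sigma>) < \<infinity>}"

definition closed_support :: "real measure \<Rightarrow> real set" where
  "closed_support \<sigma> = {x. \<forall>U. open U \<longrightarrow> x \<in> U \<longrightarrow> emeasure \<sigma> U \<noteq> 0}"

definition distribution_fun :: "real set \<Rightarrow> (real \<Rightarrow> real) \<Rightarrow> real \<Rightarrow> ennreal" where
  "distribution_fun I w y = emeasure lborel {x \<in> I. w x < y}"

end

theory Submission
  imports Defs "HOL-Complex_Analysis.Cauchy_Integral_Theorem"
begin

text \<open>
  Fix \<open>\<alpha> \<in> E\<close> and let \<open>G\<close> be the Borel transform of \<open>\<mu>\<^sub>\<alpha>\<close>. By the resolvent formula the Borel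
  transform of \<open>\<mu>\<^sub>\<beta>\<close> is \<open>F\<^sub>\<beta> = G / (1 + \<kappa> G)\<close> with \<open>\<kappa> = \<beta> - \<alpha>\<close>. Suppose that \<open>\<mu>\<^sub>\<alpha>\<close> charges a compact Lebesgue
  null set \<open>K \<subseteq> I\<close>; let \<open>\<nu>\<close> be the restriction of \<open>\<mu>\<^sub>\<alpha>\<close> to \<open>K\<close> and \<open>g\<close> its Borel transform. The
  contradiction comes from two opposite estimates of \<open>\<bar>g\<bar>\<^sup>2\<close> on the lines \<open>x + iy\<close>, \<open>y \<rightarrow> 0\<close>.

  Upper estimate (\<open>perturbation_energy_integral_le\<close>). The function
  \<open>g - \<kappa> g\<^sup>2 / (1 + \<kappa> G)\<close> is the quadratic form of the resolvent of \<open>A\<^sub>\<beta>\<close> at the indicator function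
  of \<open>K\<close>. It has nonnegative imaginary part and modulus at most \<open>\<nu>(\<real>) / Im z\<close>, and
  \<open>\<kappa>\<^sup>2 \<bar>g\<bar>\<^sup>2 Im F\<^sub>\<beta>\<close> is at most twice the sum of its imaginary part and \<open>Im g\<close>. Integration over
  \<open>I\<close> gives \<open>\<integral>\<^sub>I \<bar>g(x + iy)\<bar>\<^sup>2 Im F\<^sub>\<beta>(x + iy) dx \<le> C / \<kappa>\<^sup>2\<close> uniformly in \<open>y\<close>. This is the boundedness of
  the Cauchy transform from \<open>L\<^sup>2(\<mu>\<^sub>\<alpha>)\<close> to \<open>L\<^sup>2(\<mu>\<^sub>\<beta>)\<close> that the unitary equivalence of \<open>A\<^sub>\<alpha>\<close> and \<open>A\<^sub>\<beta>\<close>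
  provides, expressed by the transforms in the open half-plane. Since \<open>\<alpha> \<in> E\<close>, the bound can be
  integrated over \<open>\<sigma>\<close>; and \<open>\<integral> Im F\<^sub>\<beta>(x + iy) d\<sigma>(\<beta>)\<close> dominates half the mean of \<open>w\<close> over
  \<open>[x, x + y]\<close>, hence, up to a constant, \<open>w(x)\<close> for almost every \<open>x\<close> when \<open>y\<close> is small.

  Lower estimate (\<open>energy_blowup_interior\<close>, \<open>energy_blowup_atom\<close>). The transform of a singular measure is
  large on a set of measure comparable to \<open>1 / \<lambda>\<close> at every high level \<open>\<lambda>\<close>. In integrated
  form: if a set \<open>B\<close> of measure at most \<open>d\<close> is removed from \<open>I\<close>, then \<open>\<bar>g\<bar>\<^sup>2\<close> still has integral at least
  \<open>c / d\<close> over the rest, once \<open>y\<close> is small depending on \<open>d\<close> only.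

  Taking for \<open>B\<close> essentially \<open>{x \<in> I. w(x) < t}\<close>, whose measure is \<open>D\<^sub>w(t)\<close>, and integrating over
  \<open>t \<in> [0, \<delta>]\<close>, the layer cake formula turns the two estimates into \<open>\<integral>\<^sub>0\<^sup>\<delta> dt / D\<^sub>w(t) < \<infinity>\<close>
  (\<open>distribution_integral_finite\<close>), against the hypothesis.
\<close>

section \<open>Borel transforms of measures that integrate the Cauchy kernel\<close>

lemma Im_cauchy_kernel: "Im (1 / (of_real s - z)) = Im z / (cmod (of_real s - z))\<^sup>2"
  by (simp add: Im_divide cmod_power2)

lemma Im_le_cmod_of_real_diff: "Im z \<le> cmod (of_real s - z)"
  using abs_Im_le_cmod[of "of_real s - z"] by simp

text \<open>
  Besides the unperturbed measure, all the spectral measures and their restrictions to sets of finite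
  measure satisfy these assumptions.
\<close>

locale cauchy_integrable =
  fixes \<nu> :: "real measure"
  assumes sets_eq_borel [measurable_cong, simp]: "sets \<nu> = sets borel"
    and integrable_kernel: "\<And>z. Im z > 0 \<Longrightarrow> integrable \<nu> (\<lambda>s. 1 / (of_real s - z))"
begin

lemma space_eq_UNIV [simp]: "space \<nu> = UNIV"
  using sets_eq_imp_space_eq[OF sets_eq_borel] by simp

lemma integrable_poisson:
  assumes "Im z > 0"
  shows "integrable \<nu> (\<lambda>s. Im z / (cmod (of_real s - z))\<^sup>2)"
  using integrable_Im[OF integrable_kernel[OF assms]] by (simp only: Im_cauchy_kernel)

lemma Im_borel_transform:
  assumes "Im z > 0"
  shows "Im (borel_transform \<nu> z) = (LINT s|\<nu>. Im z / (cmod (of_real s - z))\<^sup>2)"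
  unfolding borel_transform_def
  using integral_Im[OF integrable_kernel[OF assms]] by (simp only: Im_cauchy_kernel)

lemma Im_borel_transform_nonneg: "Im z > 0 \<Longrightarrow> 0 \<le> Im (borel_transform \<nu> z)"
  by (simp add: Im_borel_transform integral_nonneg)

lemma Im_borel_transform_ennreal:
  assumes "Im z > 0"
  shows "ennreal (Im (borel_transform \<nu> z)) = (\<integral>\<^sup>+s. ennreal (Im z / (cmod (of_real s - z))\<^sup>2) \<partial>\<nu>)"
  using assms by (simp add: Im_borel_transform nn_integral_eq_integral[OF integrable_poisson])

lemma integrable_kernel_square:
  assumes "Im z > 0"
  shows "integrable \<nu> (\<lambda>s. 1 / (cmod (of_real s - z))\<^sup>2)"
  using integrable_divide[OF integrable_poisson[OF assms], of "Im z"] assms by simp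

text \<open>
  If the transform is not real, neither is the sum; and a measure whose transform is real at a point
  of the upper half-plane is zero.
\<close>

lemma one_plus_borel_transform_nonzero:
  assumes z: "Im z > 0"
  shows "1 + of_real k * borel_transform \<nu> z \<noteq> 0"
proof
  assume eq: "1 + of_real k * borel_transform \<nu> z = 0"
  have "Im (1 + of_real k * borel_transform \<nu> z) = k * Im (borel_transform \<nu> z)"
    by simp
  moreover from eq have "k \<noteq> 0" by auto
  ultimately have "Im (borel_transform \<nu> z) = 0" using eq by simp
  then have "AE s in \<nu>. Im z / (cmod (of_real s - z))\<^sup>2 = 0"
    using integral_nonneg_eq_0_iff_AE[OF integrable_poisson[OF z]] z
    by (simp add: Im_borel_transform)
  then have "AE s in \<nu>. 1 / (of_real s - z) = 0"
    by eventually_elim (use z in auto)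
  then have "borel_transform \<nu> z = 0"
    unfolding borel_transform_def by (rule integral_eq_zero_AE)
  with eq show False by simp
qed

text \<open>
  The difference quotient at \<open>z\<^sub>0\<close> differs from the integral of \<open>1 / (s - z\<^sub>0)\<^sup>2\<close> by
  \<open>\<integral> (z - z\<^sub>0) / ((s - z) (s - z\<^sub>0)\<^sup>2)\<close>, and \<open>\<bar>s - z\<bar> \<ge> Im z\<^sub>0 / 2\<close> near \<open>z\<^sub>0\<close>.
\<close>

lemma holomorphic_borel_transform: "borel_transform \<nu> holomorphic_on {z. Im z > 0}"
proof -
  have "\<exists>D. (borel_transform \<nu> has_field_derivative D) (at z0)" if z0: "Im z0 > 0" for z0
  proof
    let ?D = "LINT s|\<nu>. 1 / (of_real s - z0)\<^sup>2"
    let ?J = "LINT s|\<nu>. 1 / (cmod (of_real s - z0))\<^sup>2"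
    have nz: "of_real s - z \<noteq> 0" if "Im z > 0" for s z
      using that by (auto simp: complex_eq_iff)
    have int2: "integrable \<nu> (\<lambda>s. 1 / (of_real s - z0)\<^sup>2)"
      by (rule Bochner_Integration.integrable_bound[OF integrable_kernel_square[OF z0]])
        (auto simp: norm_divide norm_power)
    have bound: "cmod ((borel_transform \<nu> z - borel_transform \<nu> z0) / (z - z0) - ?D)
        \<le> cmod (z - z0) * (2 / Im z0 * ?J)"
      if z: "z \<noteq> z0" "dist z z0 < Im z0 / 2" for z
    proof -
      have "\<bar>Im (z - z0)\<bar> \<le> dist z z0" unfolding dist_norm by (rule abs_Im_le_cmod)
      then have Imz: "Im z > Im z0 / 2" using z by auto
      with z0 have pos: "Im z > 0" by linarith
      have "(borel_transform \<nu> z - borel_transform \<nu> z0) / (z - z0) - ?D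
        = (LINT s|\<nu>. (1 / (of_real s - z) - 1 / (of_real s - z0)) / (z - z0) - 1 / (of_real s - z0)\<^sup>2)"
        unfolding borel_transform_def
        using integrable_kernel[OF pos] integrable_kernel[OF z0] int2 by simp
      also have "\<dots> = (LINT s|\<nu>. (z - z0) * (1 / ((of_real s - z) * (of_real s - z0)\<^sup>2)))"
      proof (rule Bochner_Integration.integral_cong[OF refl])
        fix s
        have id: "(1 / p - 1 / q) / d - 1 / q\<^sup>2 = d * (1 / (p * q\<^sup>2))"
          if "p \<noteq> 0" "q \<noteq> 0" "d \<noteq> 0" "d = q - p" for p q d :: complex
          using that(1-3) unfolding that(4) by (simp add: field_simps power2_eq_square)
        show "(1 / (of_real s - z) - 1 / (of_real s - z0)) / (z - z0) - 1 / (of_real s - z0)\<^sup>2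
           = (z - z0) * (1 / ((of_real s - z) * (of_real s - z0)\<^sup>2))"
          using nz[OF pos, of s] nz[OF z0, of s] z(1) by (intro id) auto
      qed
      also have "cmod \<dots> \<le> (LINT s|\<nu>. cmod (z - z0) * (2 / Im z0 * (1 / (cmod (of_real s - z0))\<^sup>2)))"
      proof (rule Bochner_Integration.integral_norm_bound_integral)
        show ib: "integrable \<nu> (\<lambda>s. cmod (z - z0) * (2 / Im z0 * (1 / (cmod (of_real s - z0))\<^sup>2)))"
          using integrable_kernel_square[OF z0] by (intro integrable_mult_right)
        show le: "cmod ((z - z0) * (1 / ((of_real s - z) * (of_real s - z0)\<^sup>2)))
            \<le> cmod (z - z0) * (2 / Im z0 * (1 / (cmod (of_real s - z0))\<^sup>2))" for s
        proof -
          have "Im z0 / 2 \<le> cmod (of_real s - z)"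
            using Im_le_cmod_of_real_diff[of z s] Imz by linarith
          then have "1 / cmod (of_real s - z) \<le> 1 / (Im z0 / 2)"
            using z0 by (intro divide_left_mono) (auto intro!: mult_pos_pos)
          then have "1 / cmod (of_real s - z) * (1 / (cmod (of_real s - z0))\<^sup>2)
              \<le> 2 / Im z0 * (1 / (cmod (of_real s - z0))\<^sup>2)"
            by (intro mult_right_mono) auto
          then have "cmod (z - z0) * (1 / cmod (of_real s - z) * (1 / (cmod (of_real s - z0))\<^sup>2))
              \<le> cmod (z - z0) * (2 / Im z0 * (1 / (cmod (of_real s - z0))\<^sup>2))"
            by (rule mult_left_mono) simp
          then show ?thesis
            by (simp add: norm_mult norm_divide norm_power)
        qed
        show "integrable \<nu> (\<lambda>s. (z - z0) * (1 / ((of_real s - z) * (of_real s - z0)\<^sup>2)))"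
          by (rule Bochner_Integration.integrable_bound[OF ib]) (use le in \<open>auto simp: z0 less_imp_le abs_mult\<close>)
      qed
      also have "\<dots> = cmod (z - z0) * (2 / Im z0 * ?J)"
        by (simp only: Bochner_Integration.integral_mult_right_zero)
      finally show ?thesis .
    qed
    have "((\<lambda>z. (borel_transform \<nu> z - borel_transform \<nu> z0) / (z - z0) - ?D) \<longlongrightarrow> 0) (at z0)"
    proof (rule Lim_null_comparison)
      show "\<forall>\<^sub>F z in at z0. cmod ((borel_transform \<nu> z - borel_transform \<nu> z0) / (z - z0) - ?D)
          \<le> cmod (z - z0) * (2 / Im z0 * ?J)"
        unfolding eventually_at using z0 bound by (intro exI[of _ "Im z0 / 2"]) auto
      show "((\<lambda>z. cmod (z - z0) * (2 / Im z0 * ?J)) \<longlongrightarrow> 0) (at z0)"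
        by (rule tendsto_eq_intros refl)+ simp
    qed
    then show "(borel_transform \<nu> has_field_derivative ?D) (at z0)"
      unfolding has_field_derivative_iff by (simp add: LIM_zero_iff)
  qed
  then show ?thesis
    unfolding holomorphic_on_def field_differentiable_def
    by (auto intro: has_field_derivative_at_within)
qed

end

locale finite_cauchy_integrable = cauchy_integrable +
  assumes finite_UNIV: "emeasure \<nu> UNIV < \<infinity>"
begin

sublocale finite_measure \<nu>
  by standard (use finite_UNIV in auto)

lemma cmod_borel_transform_le:
  assumes "Im z > 0" "r > 0" "AE s in \<nu>. r \<le> cmod (of_real s - z)"
  shows "cmod (borel_transform \<nu> z) \<le> measure \<nu> UNIV / r"
proof -
  have "cmod (borel_transform \<nu> z) \<le> (LINT s|\<nu>. cmod (1 / (of_real s - z)))"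
    unfolding borel_transform_def by (rule integral_norm_bound)
  also have "\<dots> \<le> (LINT s|\<nu>. 1 / r)"
  proof (rule integral_mono_AE)
    show "integrable \<nu> (\<lambda>s. cmod (1 / (of_real s - z)))"
      using integrable_kernel[OF assms(1)] by (rule integrable_norm)
    show "AE s in \<nu>. cmod (1 / (of_real s - z)) \<le> 1 / r"
      using assms(3) by eventually_elim (use assms(2) in \<open>simp add: norm_divide frac_le\<close>)
  qed simp
  also have "\<dots> = measure \<nu> UNIV / r" by simp
  finally show ?thesis .
qed

lemma cmod_borel_transform_le_Im:
  "Im z > 0 \<Longrightarrow> cmod (borel_transform \<nu> z) \<le> measure \<nu> UNIV / Im z"
  by (rule cmod_borel_transform_le) (auto simp: Im_le_cmod_of_real_diff)

text \<open>
  The Cauchy-Schwarz inequality; the integral of \<open>1 / \<bar>s - z\<bar>\<^sup>2\<close> is the imaginary part of the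
  transform divided by \<open>Im z\<close>.
\<close>

lemma cmod_borel_transform_square_le:
  assumes z: "Im z > 0"
  shows "(cmod (borel_transform \<nu> z))\<^sup>2 \<le> measure \<nu> UNIV / Im z * Im (borel_transform \<nu> z)"
proof -
  let ?k = "\<lambda>s. 1 / (of_real s - z)"
  have sq: "(\<integral>\<^sup>+s. (ennreal (cmod (?k s)))\<^sup>2 \<partial>\<nu>) = ennreal (Im (borel_transform \<nu> z) / Im z)"
  proof -
    have "(\<integral>\<^sup>+s. (ennreal (cmod (?k s)))\<^sup>2 \<partial>\<nu>) = (\<integral>\<^sup>+s. ennreal (1 / (cmod (of_real s - z))\<^sup>2) \<partial>\<nu>)"
      by (simp add: ennreal_power norm_divide power_divide)
    also have "\<dots> = ennreal (LINT s|\<nu>. 1 / (cmod (of_real s - z))\<^sup>2)"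
      by (rule nn_integral_eq_integral[OF integrable_kernel_square[OF z]]) simp
    also have "(LINT s|\<nu>. 1 / (cmod (of_real s - z))\<^sup>2) = Im (borel_transform \<nu> z) / Im z"
      using Bochner_Integration.integral_divide_zero[of \<nu> "\<lambda>s. Im z / (cmod (of_real s - z))\<^sup>2" "Im z"] z
      by (simp add: Im_borel_transform)
    finally show ?thesis .
  qed
  have "ennreal ((cmod (borel_transform \<nu> z))\<^sup>2) \<le> (\<integral>\<^sup>+s. ennreal (cmod (?k s)) \<partial>\<nu>)\<^sup>2"
    unfolding borel_transform_def ennreal_power[OF norm_ge_zero, symmetric]
    by (intro power_mono integral_norm_bound_ennreal integrable_kernel z) simp
  also have "\<dots> \<le> (\<integral>\<^sup>+s. (ennreal (cmod (?k s)))\<^sup>2 \<partial>\<nu>) * (\<integral>\<^sup>+s. 1 \<partial>\<nu>)"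
    using Cauchy_Schwarz_nn_integral[of "\<lambda>s. ennreal (cmod (?k s))" \<nu> "\<lambda>_. 1"] by simp
  also have "\<dots> = ennreal (Im (borel_transform \<nu> z) / Im z * measure \<nu> UNIV)"
    using Im_borel_transform_nonneg[OF z] z
    by (simp add: sq emeasure_eq_measure ennreal_mult[symmetric] del: times_divide_eq_left)
  finally show ?thesis
    using Im_borel_transform_nonneg[OF z] z by (subst (asm) ennreal_le_iff) (auto simp: mult.commute)
qed

end

section \<open>Holomorphic functions on horizontal lines\<close>

text \<open>
  By Cauchy's theorem the integral over the lower side of a rectangle is minus the integral over the other
  three sides. The weight \<open>(z - a) (b - z)\<close> is nonnegative on the lower side, so that positivity of
  imaginary parts survives, and it vanishes at the two corners, where it absorbs a growth like \<open>1 / Im z\<close>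
  along the vertical sides. The bound does not depend on the height \<open>y\<close> of the lower side.
\<close>

lemma rectangle_bound:
  fixes F :: "complex \<Rightarrow> complex" and a b y m :: real
  assumes hol: "F holomorphic_on {z. Im z > 0}" and ab: "a < b" and y: "0 < y"
    and m: "\<And>z. \<lbrakk>a \<le> Re z; Re z \<le> b; 0 \<le> Im z; Im z \<le> 1; Re z = a \<or> Re z = b \<or> Im z = 1\<rbrakk>
        \<Longrightarrow> cmod ((z - of_real a) * (of_real b - z) * F (z + \<i> * of_real y)) \<le> m"
  shows "cmod (integral {a..b} (\<lambda>x. of_real ((x - a) * (b - x)) * F (Complex x y))) \<le> (b - a + 2) * m"
proof -
  let ?S = "{z. Im z > - y}"
  define f where "f z = (z - of_real a) * (of_real b - z) * F (z + \<i> * of_real y)" for z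
  have "(F \<circ> (\<lambda>z. z + \<i> * of_real y)) holomorphic_on ?S"
    by (rule holomorphic_on_compose_gen[OF _ hol]) (auto intro!: holomorphic_intros)
  then have holf: "f holomorphic_on ?S"
    unfolding f_def o_def by (intro holomorphic_intros) auto
  obtain g where g: "\<And>z. z \<in> ?S \<Longrightarrow> (g has_field_derivative f z) (at z within ?S)"
    using holomorphic_convex_primitive'[OF convex_halfspace_Im_gt open_halfspace_Im_gt holf] by metis
  have g': "(g has_field_derivative f z) (at z)" if "Im z \<ge> 0" for z
    using g[of z] at_within_open[of z ?S] that y by (simp add: open_halfspace_Im_gt)
  have seg: "cmod (g u - g v) \<le> m * cmod (u - v)"
    if "\<And>z. z \<in> closed_segment u v \<Longrightarrow> a \<le> Re z \<and> Re z \<le> b \<and> 0 \<le> Im z \<and> Im z \<le> 1 \<and> (Re z = a \<or> Re z = b \<or> Im z = 1)"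
    for u v
  proof (rule field_differentiable_bound[of "closed_segment u v" g f])
    fix z assume z: "z \<in> closed_segment u v"
    note * = that[OF z]
    show "(g has_field_derivative f z) (at z within closed_segment u v)"
      using g'[of z] * by (auto intro: has_field_derivative_at_within)
    show "cmod (f z) \<le> m" unfolding f_def using * by (intro m) auto
  qed auto
  have vert: "closed_segment (Complex c 0) (Complex c 1) \<subseteq> {z. Re z = c \<and> 0 \<le> Im z \<and> Im z \<le> 1}" for c
  proof (intro closed_segment_subset)
    have "{z. Re z = c \<and> 0 \<le> Im z \<and> Im z \<le> 1} = {z. Re z \<ge> c} \<inter> {z. Re z \<le> c} \<inter> {z. Im z \<ge> 0} \<inter> {z. Im z \<le> 1}"
      by auto
    then show "convex {z. Re z = c \<and> 0 \<le> Im z \<and> Im z \<le> 1}"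
      by (simp add: convex_Int convex_halfspace_Im_ge convex_halfspace_Im_le convex_halfspace_Re_ge convex_halfspace_Re_le)
  qed auto
  have horiz: "closed_segment (Complex a 1) (Complex b 1) \<subseteq> {z. Im z = 1 \<and> a \<le> Re z \<and> Re z \<le> b}"
  proof (intro closed_segment_subset)
    have "{z. Im z = 1 \<and> a \<le> Re z \<and> Re z \<le> b} = {z. Im z \<ge> 1} \<inter> {z. Im z \<le> 1} \<inter> {z. Re z \<ge> a} \<inter> {z. Re z \<le> b}"
      by auto
    then show "convex {z. Im z = 1 \<and> a \<le> Re z \<and> Re z \<le> b}"
      by (simp add: convex_Int convex_halfspace_Re_ge convex_halfspace_Re_le convex_halfspace_Im_ge convex_halfspace_Im_le)
  qed (use ab in auto)
  have "((\<lambda>x. f (of_real x)) has_integral g (of_real b) - g (of_real a)) {a..b}"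
  proof (rule fundamental_theorem_of_calculus)
    fix x
    have "(g has_field_derivative f (of_real x)) (at (of_real x))" by (rule g') simp
    then show "((\<lambda>x. g (of_real x)) has_vector_derivative f (of_real x)) (at x within {a..b})"
      by (rule has_vector_derivative_real_field)
  qed (use ab in simp)
  moreover have "f (of_real x) = of_real ((x - a) * (b - x)) * F (Complex x y)" for x
  proof -
    have "complex_of_real x + \<i> * of_real y = Complex x y" by (simp add: complex_eq_iff)
    then show ?thesis by (simp add: f_def)
  qed
  ultimately have "integral {a..b} (\<lambda>x. of_real ((x - a) * (b - x)) * F (Complex x y))
      = g (of_real b) - g (of_real a)"
    by (simp add: integral_unique)
  also have "cmod \<dots> \<le> cmod (g (Complex b 0) - g (Complex b 1)) + cmod (g (Complex a 1) - g (Complex b 1))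
      + cmod (g (Complex a 0) - g (Complex a 1))"
  proof -
    have eq: "g (of_real b) - g (of_real a) = (g (Complex b 0) - g (Complex b 1))
        - (g (Complex a 1) - g (Complex b 1)) - (g (Complex a 0) - g (Complex a 1))"
      by (simp add: complex_of_real_def)
    have "cmod (p - q - r) \<le> cmod p + cmod q + cmod r" for p q r
      using norm_triangle_ineq4[of "p - q" r] norm_triangle_ineq4[of p q] by linarith
    then show ?thesis unfolding eq .
  qed
  also have "\<dots> \<le> m * cmod (Complex b 0 - Complex b 1) + m * cmod (Complex a 1 - Complex b 1)
      + m * cmod (Complex a 0 - Complex a 1)"
    by (intro add_mono seg) (use vert[of a] vert[of b] horiz ab in auto)
  also have "\<dots> = (b - a + 2) * m"
    using ab by (simp add: cmod_def algebra_simps)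
  finally show ?thesis .
qed

lemma nn_integral_Icc_eq_integral:
  fixes f :: "real \<Rightarrow> real"
  assumes int: "set_integrable lborel {a..b} f" and nonneg: "\<And>x. x \<in> {a..b} \<Longrightarrow> 0 \<le> f x"
  shows "(\<integral>\<^sup>+x\<in>{a..b}. ennreal (f x) \<partial>lborel) = ennreal (integral {a..b} f)"
proof -
  have "(\<integral>\<^sup>+x\<in>{a..b}. ennreal (f x) \<partial>lborel) = (\<integral>\<^sup>+x. ennreal (indicator {a..b} x *\<^sub>R f x) \<partial>lborel)"
    by (intro nn_integral_cong) (auto split: split_indicator)
  also have "\<dots> = ennreal (LINT x|lborel. indicator {a..b} x *\<^sub>R f x)"
    by (rule nn_integral_eq_integral)
      (use int nonneg in \<open>auto simp: set_integrable_def split: split_indicator\<close>)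
  also have "(LINT x|lborel. indicator {a..b} x *\<^sub>R f x) = integral {a..b} f"
    using set_borel_integral_eq_integral(2)[OF int] by (simp add: set_lebesgue_integral_def)
  finally show ?thesis .
qed

lemmas nn_integral_continuous_interval =
  nn_integral_Icc_eq_integral[OF borel_integrable_atLeastAtMost']

lemma bounded_set_integrable_Icc:
  fixes u :: "real \<Rightarrow> real"
  assumes [measurable]: "u \<in> borel_measurable borel" and bdd: "\<And>x. \<bar>u x\<bar> \<le> C"
  shows "set_integrable lborel {c..d} u"
  unfolding set_integrable_def
proof (rule Bochner_Integration.integrable_bound)
  show "integrable lborel (\<lambda>x. C * indicator {c..d} x)"
    by (intro integrable_mult_right integrable_real_indicator) (auto simp: emeasure_lborel_Icc_eq)
qed (use bdd in \<open>auto split: split_indicator intro: order_trans[OF _ abs_ge_self]\<close>)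

lemma continuous_on_horizontal_line:
  assumes "F holomorphic_on {z. Im z > 0}" "y > 0"
  shows "continuous_on A (\<lambda>x. F (Complex x y))"
proof -
  have "continuous_on A (\<lambda>x. Complex x y)"
    unfolding Complex_eq by (intro continuous_intros)
  then show ?thesis
    by (rule continuous_on_compose2[OF holomorphic_on_imp_continuous_on[OF assms(1)]]) (use assms(2) in auto)
qed

lemma Im_weighted_integral:
  fixes a b y :: real
  assumes hol: "F holomorphic_on {z. Im z > 0}" and y: "0 < y" 
  shows "Im (integral {a..b} (\<lambda>x. of_real ((x - a) * (b - x)) * F (Complex x y)))
    = integral {a..b} (\<lambda>x. (x - a) * (b - x) * Im (F (Complex x y)))"
proof -
  have "(\<lambda>x. of_real ((x - a) * (b - x)) * F (Complex x y)) integrable_on {a..b}"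
    by (intro integrable_continuous_real continuous_intros continuous_on_horizontal_line[OF hol y])
  then have "(Im \<circ> (\<lambda>x. of_real ((x - a) * (b - x)) * F (Complex x y)) has_integral
      Im (integral {a..b} (\<lambda>x. of_real ((x - a) * (b - x)) * F (Complex x y)))) {a..b}"
    by (intro has_integral_linear bounded_linear_Im) (simp add: integrable_integral)
  then show ?thesis by (simp add: o_def integral_unique)
qed

text \<open>
  For a function with these properties the integral of the imaginary part over a whole line is at most
  \<open>\<pi> m\<close>. The rectangle gives a local form of this with a worse constant: over \<open>[a - 1, b + 1]\<close> the weight
  is at least 1 on \<open>[a, b]\<close>.
\<close>

lemma nn_integral_Im_le:
  fixes a b y m :: real
  assumes hol: "F holomorphic_on {z. Im z > 0}" and ab: "a < b" and y: "0 < y"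
    and nonneg: "\<And>z. Im z > 0 \<Longrightarrow> 0 \<le> Im (F z)"
    and le: "\<And>z. Im z > 0 \<Longrightarrow> cmod (F z) \<le> m / Im z" and m: "0 \<le> m"
  shows "(\<integral>\<^sup>+x\<in>{a..b}. ennreal (Im (F (Complex x y))) \<partial>lborel) \<le> ennreal ((b - a + 4) * (b - a + 3)\<^sup>2 * m)"
proof -
  let ?a = "a - 1" and ?b = "b + 1"
  let ?q = "\<lambda>x. (x - ?a) * (?b - x)"
  have q1: "1 \<le> ?q x" if "x \<in> {a..b}" for x
  proof -
    have "1 * 1 \<le> ?q x" by (rule mult_mono) (use that in auto)
    then show ?thesis by simp
  qed
  have cont: "continuous_on {?a..?b} (\<lambda>x. ?q x * Im (F (Complex x y)))"
    by (intro continuous_intros continuous_on_horizontal_line[OF hol y])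
  have "integral {?a..?b} (\<lambda>x. ?q x * Im (F (Complex x y)))
      = Im (integral {?a..?b} (\<lambda>x. of_real (?q x) * F (Complex x y)))"
    by (rule Im_weighted_integral[OF hol y, symmetric])
  also have "\<dots> \<le> cmod (integral {?a..?b} (\<lambda>x. of_real (?q x) * F (Complex x y)))"
    by (rule order_trans[OF abs_ge_self abs_Im_le_cmod])
  also have "\<dots> \<le> (?b - ?a + 2) * ((b - a + 3)\<^sup>2 * m)"
  proof (rule rectangle_bound[OF hol _ y])
    fix z assume z: "?a \<le> Re z" "Re z \<le> ?b" "0 \<le> Im z" "Im z \<le> 1" "Re z = ?a \<or> Re z = ?b \<or> Im z = 1"
    let ?L = "b - a + 3"
    have L1: "1 \<le> ?L" using ab by simp
    have za: "cmod (z - of_real ?a) \<le> ?L"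
      by (rule order_trans[OF cmod_le]) (use z in auto)
    have zb: "cmod (of_real ?b - z) \<le> ?L"
      by (rule order_trans[OF cmod_le]) (use z in auto)
    have "cmod (F (z + \<i> * of_real y)) \<le> m / (Im z + y)"
      using le[of "z + \<i> * of_real y"] z y by simp
    then have "Im z * cmod (F (z + \<i> * of_real y)) \<le> Im z * (m / (Im z + y))"
      by (rule mult_left_mono) (use z in simp)
    also have "\<dots> = m * (Im z / (Im z + y))" by simp
    also have "\<dots> \<le> m * 1"
      by (rule mult_left_mono[OF _ m]) (use z y in \<open>simp add: divide_le_eq\<close>)
    finally have F: "Im z * cmod (F (z + \<i> * of_real y)) \<le> m" by simp
    have *: "cmod (z - of_real ?a) * cmod (of_real ?b - z) \<le> ?L\<^sup>2 * Im z"
      using z(5)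
    proof (elim disjE)
      assume "Re z = ?a"
      then have eq: "cmod (z - of_real ?a) = Im z" using z by (simp add: cmod_def)
      have "cmod (of_real ?b - z) \<le> ?L\<^sup>2" using zb self_le_power[OF L1, of 2] by simp
      then have "Im z * cmod (of_real ?b - z) \<le> Im z * ?L\<^sup>2" using z(3) by (rule mult_left_mono)
      then show ?thesis unfolding eq by (simp only: mult.commute)
    next
      assume "Re z = ?b"
      then have eq: "cmod (of_real ?b - z) = Im z" using z by (simp add: cmod_def)
      have "cmod (z - of_real ?a) \<le> ?L\<^sup>2" using za self_le_power[OF L1, of 2] by simp
      then show ?thesis unfolding eq using z by (simp add: mult_right_mono)
    next
      assume "Im z = 1"
      moreover have "cmod (z - of_real ?a) * cmod (of_real ?b - z) \<le> ?L * ?L"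
        by (rule mult_mono[OF za zb]) (use L1 in simp_all)
      ultimately show ?thesis by (simp only: power2_eq_square mult_1_right)
    qed
    have "cmod ((z - of_real ?a) * (of_real ?b - z) * F (z + \<i> * of_real y))
        \<le> ?L\<^sup>2 * Im z * cmod (F (z + \<i> * of_real y))"
      unfolding norm_mult by (rule mult_right_mono[OF *]) simp
    also have "\<dots> \<le> ?L\<^sup>2 * m"
      using F by (simp add: mult.assoc mult_left_mono)
    finally show "cmod ((z - of_real ?a) * (of_real ?b - z) * F (z + \<i> * of_real y)) \<le> ?L\<^sup>2 * m" .
  qed (use ab in simp)
  also have "(?b - ?a + 2) * ((b - a + 3)\<^sup>2 * m) = (b - a + 4) * (b - a + 3)\<^sup>2 * m"
    by simp
  finally have bound: "integral {?a..?b} (\<lambda>x. ?q x * Im (F (Complex x y))) \<le> (b - a + 4) * (b - a + 3)\<^sup>2 * m" .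
  have "(\<integral>\<^sup>+x\<in>{a..b}. ennreal (Im (F (Complex x y))) \<partial>lborel)
      \<le> (\<integral>\<^sup>+x\<in>{?a..?b}. ennreal (?q x * Im (F (Complex x y))) \<partial>lborel)"
  proof (intro nn_integral_mono)
    fix x
    show "ennreal (Im (F (Complex x y))) * indicator {a..b} x
        \<le> ennreal (?q x * Im (F (Complex x y))) * indicator {?a..?b} x"
    proof (cases "x \<in> {a..b}")
      case True
      then have "1 * Im (F (Complex x y)) \<le> ?q x * Im (F (Complex x y))"
        by (intro mult_right_mono q1 nonneg) (use y in auto)
      with True show ?thesis by (auto intro: ennreal_leI)
    qed simp
  qed
  also have "\<dots> = ennreal (integral {?a..?b} (\<lambda>x. ?q x * Im (F (Complex x y))))"
    by (rule nn_integral_continuous_interval[OF cont]) (intro mult_nonneg_nonneg nonneg, use y in auto)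
  also have "\<dots> \<le> ennreal ((b - a + 4) * (b - a + 3)\<^sup>2 * m)"
    by (rule ennreal_leI[OF bound])
  finally show ?thesis .
qed

section \<open>The energy bound for rank one perturbations\<close>

text \<open>
  In the \<open>L\<^sup>2\<close> space of the measure \<open>N\<close> with transform \<open>G\<close>, let \<open>g\<close> be the transform of the
  restriction of \<open>N\<close> to a set \<open>K\<close>. The resolvent of the perturbation with coupling \<open>k\<close> maps the indicator
  function of \<open>K\<close> to \<open>(1\<^sub>K + v) / (t - z)\<close>, and \<open>g (1 + v)\<close> is the corresponding value of the quadratic
  form. Its imaginary part is \<open>Im z\<close> times the squared norm of \<open>(1\<^sub>K + v) / (t - z)\<close>; the two summands below
  are the parts of this norm outside and inside \<open>K\<close>. The left-hand side of the second claim is \<open>Im G \<bar>v\<bar>\<^sup>2\<close>,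
  the same expression without the indicator function, which the triangle inequality bounds.
\<close>

lemma perturbation_energy:
  fixes G g :: complex and k :: real
  assumes gG: "Im g \<le> Im G" "0 \<le> Im g" and nz: "1 + of_real k * G \<noteq> 0"
  defines "v \<equiv> - of_real k * g / (1 + of_real k * G)"
  shows "Im (g * (1 + v)) = (Im G - Im g) * (cmod v)\<^sup>2 + Im g * (cmod (1 + v))\<^sup>2"
    and "k\<^sup>2 * (cmod g)\<^sup>2 * Im (G / (1 + of_real k * G)) \<le> 2 * (Im (g * (1 + v)) + Im g)"
proof -
  define u where "u = g + G * v"
  \<comment> \<open>\<open>u\<close> is the integral of \<open>(1\<^sub>K + v) / (t - z)\<close>; as \<open>v\<close> is a real multiple of it, \<open>cnj v * u\<close> is real.\<close>
  have vu: "v = - of_real k * u"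
    unfolding u_def v_def using nz by (simp add: field_simps)
  then have "Im (cnj v * u) = 0" by simp
  then show eq: "Im (g * (1 + v)) = (Im G - Im g) * (cmod v)\<^sup>2 + Im g * (cmod (1 + v))\<^sup>2"
    unfolding u_def cmod_power2 by (simp add: power2_eq_square algebra_simps)
  have "Im (G / (1 + of_real k * G)) = Im G / (cmod (1 + of_real k * G))\<^sup>2"
    unfolding complex_div_cnj[of G] by (simp add: Im_divide cmod_power2 algebra_simps power2_eq_square)
  then have "k\<^sup>2 * (cmod g)\<^sup>2 * Im (G / (1 + of_real k * G)) = Im G * (cmod v)\<^sup>2"
    by (simp add: v_def norm_mult norm_divide power_mult_distrib power_divide)
  also have "\<dots> = (Im G - Im g) * (cmod v)\<^sup>2 + Im g * (cmod v)\<^sup>2" by (simp add: algebra_simps)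
  also have "\<dots> \<le> 2 * ((Im G - Im g) * (cmod v)\<^sup>2) + Im g * (2 * (cmod (1 + v))\<^sup>2 + 2)"
  proof (intro add_mono mult_left_mono)
    have "cmod v \<le> cmod (1 + v) + 1"
      using norm_triangle_ineq4[of "1 + v" 1] by simp
    then have "(cmod v)\<^sup>2 \<le> (cmod (1 + v) + 1)\<^sup>2" by (intro power_mono) auto
    also have "\<dots> \<le> 2 * (cmod (1 + v))\<^sup>2 + 2"
      using zero_le_power2[of "cmod (1 + v) - 1"] by (simp add: power2_eq_square algebra_simps)
    finally show "(cmod v)\<^sup>2 \<le> 2 * (cmod (1 + v))\<^sup>2 + 2" .
    have "0 \<le> (Im G - Im g) * (cmod v)\<^sup>2" using gG by simp
    then show "(Im G - Im g) * (cmod v)\<^sup>2 \<le> 2 * ((Im G - Im g) * (cmod v)\<^sup>2)" by linarith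
  qed (use gG in auto)
  also have "\<dots> = 2 * (Im (g * (1 + v)) + Im g)"
    unfolding eq by (simp add: algebra_simps)
  finally show "k\<^sup>2 * (cmod g)\<^sup>2 * Im (G / (1 + of_real k * G)) \<le> 2 * (Im (g * (1 + v)) + Im g)" .
qed

lemma (in cauchy_integrable) finite_cauchy_integrable_restriction:
  assumes K: "K \<in> sets borel" and fin: "emeasure \<nu> K < \<infinity>"
  shows "finite_cauchy_integrable (density \<nu> (indicator K))"
proof
  show "sets (density \<nu> (indicator K)) = sets borel" by simp
  show "emeasure (density \<nu> (indicator K)) UNIV < \<infinity>"
    using fin K by (simp add: emeasure_density)
next
  fix z :: complex assume "Im z > 0"
  then have "integrable \<nu> (\<lambda>s. indicator K s *\<^sub>R (1 / (of_real s - z)))"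
    using K by (intro integrable_mult_indicator integrable_kernel) auto
  then show "integrable (density \<nu> (indicator K)) (\<lambda>s. 1 / (of_real s - z))"
    using K integrable_density[of "\<lambda>s. 1 / (of_real s - z)" \<nu> "indicat_real K"]
    by (simp add: ennreal_indicator)
qed

lemma (in cauchy_integrable) Im_borel_transform_restriction_le:
  assumes K: "K \<in> sets borel" and fin: "emeasure \<nu> K < \<infinity>" and z: "Im z > 0"
  shows "Im (borel_transform (density \<nu> (indicator K)) z) \<le> Im (borel_transform \<nu> z)"
proof -
  interpret r: finite_cauchy_integrable "density \<nu> (indicator K)"
    by (rule finite_cauchy_integrable_restriction[OF K fin])
  have "ennreal (Im (borel_transform (density \<nu> (indicator K)) z))
      = (\<integral>\<^sup>+s. indicator K s * ennreal (Im z / (cmod (of_real s - z))\<^sup>2) \<partial>\<nu>)"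
    unfolding r.Im_borel_transform_ennreal[OF z] using K by (subst nn_integral_density) auto
  also have "\<dots> \<le> ennreal (Im (borel_transform \<nu> z))"
    unfolding Im_borel_transform_ennreal[OF z]
    by (intro nn_integral_mono) (auto split: split_indicator)
  finally show ?thesis
    using Im_borel_transform_nonneg[OF z] by simp
qed

text \<open>
  The measure \<open>N\<close> plays the role of \<open>\<mu>\<^sub>\<alpha>\<close> and \<open>k\<close> that of \<open>\<beta> - \<alpha>\<close>. The factor \<open>1 / k\<^sup>2\<close> is what makes
  the finite energy condition on \<open>\<alpha>\<close> sufficient for averaging over \<open>\<beta>\<close>.
\<close>

lemma perturbation_energy_integral_le:
  fixes a b y k :: real
  assumes N: "cauchy_integrable N" and \<nu>: "finite_cauchy_integrable \<nu>"
    and le: "\<And>z. Im z > 0 \<Longrightarrow> Im (borel_transform \<nu> z) \<le> Im (borel_transform N z)"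
    and k: "k \<noteq> 0" and y: "0 < y" and ab: "a < b"
  shows "(\<integral>\<^sup>+x\<in>{a..b}. ennreal ((cmod (borel_transform \<nu> (Complex x y)))\<^sup>2 *
            Im (borel_transform N (Complex x y) / (1 + of_real k * borel_transform N (Complex x y)))) \<partial>lborel)
      \<le> ennreal (4 * (b - a + 4) * (b - a + 3)\<^sup>2 * measure \<nu> UNIV / k\<^sup>2)"
proof -
  interpret N: cauchy_integrable N by fact
  interpret \<nu>: finite_cauchy_integrable \<nu> by fact
  let ?G = "borel_transform N" and ?g = "borel_transform \<nu>" and ?m = "measure \<nu> UNIV"
  define F where "F z = ?g z * (1 + - of_real k * ?g z / (1 + of_real k * ?G z))" for z
  have holF: "F holomorphic_on {z. Im z > 0}"
    unfolding F_def
    by (intro holomorphic_intros N.holomorphic_borel_transform \<nu>.holomorphic_borel_transform)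
      (auto simp: N.one_plus_borel_transform_nonzero)
  have Im_F: "Im (F z) = (Im (?G z) - Im (?g z)) * (cmod (- of_real k * ?g z / (1 + of_real k * ?G z)))\<^sup>2
      + Im (?g z) * (cmod (1 + - of_real k * ?g z / (1 + of_real k * ?G z)))\<^sup>2" if "Im z > 0" for z
    unfolding F_def
    by (rule perturbation_energy(1)[OF le \<nu>.Im_borel_transform_nonneg N.one_plus_borel_transform_nonzero])
      (rule that)+
  have F_nonneg: "0 \<le> Im (F z)" if "Im z > 0" for z
    by (subst Im_F) (use le[OF that] \<nu>.Im_borel_transform_nonneg[OF that] that in auto)
  \<comment> \<open>By Cauchy-Schwarz \<open>\<bar>F\<bar>\<^sup>2 \<le> m / Im z * Im F\<close>, and \<open>Im F \<le> \<bar>F\<bar>\<close>; this is the norm bound of a resolvent.\<close>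
  have F_le: "cmod (F z) \<le> ?m / Im z" if z: "Im z > 0" for z
  proof -
    let ?v = "- of_real k * ?g z / (1 + of_real k * ?G z)"
    have "(cmod (F z))\<^sup>2 = (cmod (?g z))\<^sup>2 * (cmod (1 + ?v))\<^sup>2"
      by (simp add: F_def norm_mult power_mult_distrib)
    also have "\<dots> \<le> (?m / Im z * Im (?g z)) * (cmod (1 + ?v))\<^sup>2"
      by (intro mult_right_mono \<nu>.cmod_borel_transform_square_le z) simp
    also have "\<dots> = ?m / Im z * (Im (?g z) * (cmod (1 + ?v))\<^sup>2)" by simp
    also have "\<dots> \<le> ?m / Im z * Im (F z)"
      by (intro mult_left_mono, subst Im_F) (use z le[OF z] in auto)
    also have "\<dots> \<le> ?m / Im z * cmod (F z)"
      using z abs_Im_le_cmod[of "F z"] by (intro mult_left_mono) auto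
    finally have "cmod (F z) * cmod (F z) \<le> ?m / Im z * cmod (F z)" by (simp add: power2_eq_square)
    then show ?thesis
      using z by (cases "F z = 0") (auto dest: mult_right_le_imp_le simp del: times_divide_eq_left)
  qed
  have pointwise: "(cmod (?g z))\<^sup>2 * Im (?G z / (1 + of_real k * ?G z)) \<le> (2 * Im (F z) + 2 * Im (?g z)) / k\<^sup>2"
    if z: "Im z > 0" for z
  proof -
    have "k\<^sup>2 * ((cmod (?g z))\<^sup>2 * Im (?G z / (1 + of_real k * ?G z))) \<le> 2 * (Im (F z) + Im (?g z))"
      using perturbation_energy(2)[OF le[OF z] \<nu>.Im_borel_transform_nonneg[OF z] N.one_plus_borel_transform_nonzero[OF z]]
      by (simp add: F_def mult.assoc)
    then show ?thesis using k by (simp add: field_simps)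
  qed
  have meas: "(\<lambda>x. Im (F (Complex x y))) \<in> borel_measurable borel"
      "(\<lambda>x. Im (?g (Complex x y))) \<in> borel_measurable borel"
    by (intro borel_measurable_continuous_onI continuous_intros continuous_on_horizontal_line[OF _ y]
        holF \<nu>.holomorphic_borel_transform)+
  let ?C = "(b - a + 4) * (b - a + 3)\<^sup>2 * ?m"
  have C: "0 \<le> ?C" using ab by simp
  have "(\<integral>\<^sup>+x\<in>{a..b}. ennreal ((cmod (?g (Complex x y)))\<^sup>2 *
            Im (?G (Complex x y) / (1 + of_real k * ?G (Complex x y)))) \<partial>lborel)
     \<le> (\<integral>\<^sup>+x. ennreal (2 / k\<^sup>2) * (ennreal (Im (F (Complex x y))) * indicator {a..b} x
            + ennreal (Im (?g (Complex x y))) * indicator {a..b} x) \<partial>lborel)"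
    using y
    by (intro nn_integral_mono)
      (auto split: split_indicator simp: ennreal_mult[symmetric] ennreal_plus[symmetric] F_nonneg
         \<nu>.Im_borel_transform_nonneg pointwise simp del: ennreal_plus intro!: ennreal_leI)
  also have "\<dots> = ennreal (2 / k\<^sup>2) * ((\<integral>\<^sup>+x\<in>{a..b}. ennreal (Im (F (Complex x y))) \<partial>lborel)
            + (\<integral>\<^sup>+x\<in>{a..b}. ennreal (Im (?g (Complex x y))) \<partial>lborel))"
    using meas by (subst nn_integral_cmult) (auto simp: nn_integral_add)
  also have "\<dots> \<le> ennreal (2 / k\<^sup>2) * (ennreal ?C + ennreal ?C)"
    by (intro mult_left_mono add_mono nn_integral_Im_le holF F_nonneg F_le y ab
        \<nu>.holomorphic_borel_transform \<nu>.Im_borel_transform_nonneg \<nu>.cmod_borel_transform_le_Im) auto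
  also have "\<dots> = ennreal (2 / k\<^sup>2 * (?C + ?C))"
  proof -
    have "ennreal p * (ennreal q + ennreal q) = ennreal (p * (q + q))" if "0 \<le> p" "0 \<le> q" for p q
      using that by (simp add: ennreal_mult distrib_left flip: ennreal_plus)
    note * = this
    show ?thesis by (rule *[OF _ C]) simp
  qed
  also have "2 / k\<^sup>2 * (?C + ?C) = 4 * (b - a + 4) * (b - a + 3)\<^sup>2 * ?m / k\<^sup>2" by simp
  finally show ?thesis .
qed

section \<open>Concentration of the energy of singular measures\<close>

text \<open>
  An integrated form of the statement that \<open>\<bar>g(x + iy)\<bar>\<close> exceeds every high level \<open>\<lambda>\<close> on a subset of
  \<open>[a, b]\<close> of measure at least \<open>const / \<lambda>\<close>: such a set of measure \<open>2 d\<close> cannot be removed by a \<open>B\<close> of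
  measure \<open>d\<close>. The constant \<open>c\<close> depends neither on \<open>d\<close> nor on \<open>B\<close>, and the threshold for \<open>y\<close> does not
  depend on \<open>B\<close>, since the sets to be removed will themselves vary with \<open>y\<close>.
\<close>

definition energy_blowup :: "real \<Rightarrow> real \<Rightarrow> (complex \<Rightarrow> complex) \<Rightarrow> bool" where
  "energy_blowup a b g \<longleftrightarrow> (\<exists>c>0. \<exists>d\<^sub>0>0. \<forall>d. 0 < d \<and> d \<le> d\<^sub>0 \<longrightarrow>
     (\<exists>y\<^sub>0>0. \<forall>y. 0 < y \<and> y < y\<^sub>0 \<longrightarrow>
       (\<forall>B\<in>sets borel. emeasure lborel B \<le> ennreal d \<longrightarrow>
          ennreal (c / d) \<le> (\<integral>\<^sup>+x\<in>{a..b} - B. ennreal ((cmod (g (Complex x y)))\<^sup>2) \<partial>lborel))))"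

text \<open>
  The transform of an atom at \<open>e\<close> is \<open>m / (e - z)\<close>. As \<open>e\<close> may be an end point of the interval, only
  one side of \<open>e\<close> is available; an interval of length \<open>2 d\<close> with end point \<open>e\<close> loses at most half its
  measure by removing \<open>B\<close>.
\<close>

lemma energy_blowup_atom:
  fixes a b e :: real
  assumes \<nu>: "finite_cauchy_integrable \<nu>" and e: "e \<in> {a..b}" and ab: "a < b"
    and conc: "AE s in \<nu>. s = e" and pos: "0 < measure \<nu> UNIV"
  shows "energy_blowup a b (borel_transform \<nu>)"
proof -
  interpret finite_cauchy_integrable \<nu> by fact
  let ?m = "measure \<nu> UNIV"
  have bt: "borel_transform \<nu> z = of_real ?m / (of_real e - z)" if "Im z > 0" for z
  proof -
    have "borel_transform \<nu> z = (LINT s|\<nu>. 1 / (of_real e - z))"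
      unfolding borel_transform_def
      by (rule integral_cong_AE) (use conc in \<open>auto elim: eventually_mono\<close>)
    also have "\<dots> = of_real ?m / (of_real e - z)" by (simp add: scaleR_conv_of_real)
    finally show ?thesis .
  qed
  have "ennreal (?m\<^sup>2 / 5 / d) \<le> (\<integral>\<^sup>+x\<in>{a..b} - B. ennreal ((cmod (borel_transform \<nu> (Complex x y)))\<^sup>2) \<partial>lborel)"
    if d: "0 < d" "d \<le> (b - a) / 4" and y: "0 < y" "y < d"
      and B: "B \<in> sets borel" "emeasure lborel B \<le> ennreal d" for d y B
  proof -
    obtain p where p: "{p..p + 2 * d} \<subseteq> {a..b} \<inter> {e - 2 * d..e + 2 * d}"
    proof (cases "e + 2 * d \<le> b")
      case True
      then show ?thesis using e d by (intro that[of e]) auto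
    next
      case False
      then show ?thesis using e d by (intro that[of "e - 2 * d"]) auto
    qed
    let ?J = "{p..p + 2 * d}"
    have "ennreal (2 * d) = emeasure lborel ?J" using d by simp
    also have "\<dots> \<le> emeasure lborel (?J - B) + emeasure lborel B"
      by (rule order_trans[OF emeasure_mono emeasure_subadditive]) (use B in auto)
    also have "\<dots> \<le> emeasure lborel (?J - B) + ennreal d" using B by (intro add_left_mono)
    finally have "ennreal (2 * d) - ennreal d \<le> emeasure lborel (?J - B)"
      by (simp add: ennreal_minus_le_iff add.commute)
    then have J: "ennreal d \<le> emeasure lborel (?J - B)"
      using d by (simp add: ennreal_minus)
    have "ennreal (?m\<^sup>2 / 5 / d) = ennreal (?m\<^sup>2 / (5 * d\<^sup>2)) * ennreal d"
      using d by (simp add: ennreal_mult[symmetric] power2_eq_square)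
    also have "\<dots> \<le> ennreal (?m\<^sup>2 / (5 * d\<^sup>2)) * emeasure lborel (?J - B)"
      by (rule mult_left_mono[OF J]) simp
    also have "\<dots> = (\<integral>\<^sup>+x\<in>?J - B. ennreal (?m\<^sup>2 / (5 * d\<^sup>2)) \<partial>lborel)"
      using B by (simp add: nn_integral_cmult_indicator)
    also have "\<dots> \<le> (\<integral>\<^sup>+x\<in>{a..b} - B. ennreal ((cmod (borel_transform \<nu> (Complex x y)))\<^sup>2) \<partial>lborel)"
    proof (rule nn_integral_mono)
      fix x
      show "ennreal (?m\<^sup>2 / (5 * d\<^sup>2)) * indicator (?J - B) x
          \<le> ennreal ((cmod (borel_transform \<nu> (Complex x y)))\<^sup>2) * indicator ({a..b} - B) x"
      proof (cases "x \<in> ?J - B")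
        case True
        have eq: "(cmod (borel_transform \<nu> (Complex x y)))\<^sup>2 = ?m\<^sup>2 / ((e - x)\<^sup>2 + y\<^sup>2)"
          using y by (simp add: bt norm_divide power_divide cmod_power2)
        have "\<bar>e - x\<bar> \<le> 2 * d" using True p by auto
        then have "(e - x)\<^sup>2 \<le> (2 * d)\<^sup>2" by (metis abs_ge_zero power2_abs power_mono)
        moreover have "y\<^sup>2 \<le> d\<^sup>2" using y by (intro power_mono) auto
        ultimately have "(e - x)\<^sup>2 + y\<^sup>2 \<le> 5 * d\<^sup>2"
          by (simp add: power_mult_distrib)
        then have "?m\<^sup>2 / (5 * d\<^sup>2) \<le> ?m\<^sup>2 / ((e - x)\<^sup>2 + y\<^sup>2)"
          by (rule divide_left_mono) (use y d in \<open>auto intro!: mult_pos_pos add_nonneg_pos\<close>)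
        with True p show ?thesis by (auto simp: eq intro!: ennreal_leI split: split_indicator)
      qed simp
    qed
    finally show ?thesis .
  qed
  then have "\<exists>y\<^sub>0>0. \<forall>y. 0 < y \<and> y < y\<^sub>0 \<longrightarrow> (\<forall>B\<in>sets borel. emeasure lborel B \<le> ennreal d \<longrightarrow>
      ennreal (?m\<^sup>2 / 5 / d) \<le> (\<integral>\<^sup>+x\<in>{a..b} - B. ennreal ((cmod (borel_transform \<nu> (Complex x y)))\<^sup>2) \<partial>lborel))"
    if "0 < d" "d \<le> (b - a) / 4" for d
    using that by blast
  moreover have "0 < ?m\<^sup>2 / 5" "0 < (b - a) / 4" using pos ab by auto
  ultimately show ?thesis unfolding energy_blowup_def by blast
qed

text \<open>
  The Moebius transformation \<open>w \<mapsto> i l w / (w + i l)\<close> maps the upper half-plane into itself, is close to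
  the identity where \<open>\<bar>w\<bar>\<close> is much smaller than \<open>l\<close>, and has imaginary part at most \<open>l\<close>.
\<close>

lemma truncation_bounds:
  fixes g :: complex and l :: real
  assumes g: "0 \<le> Im g" and l: "0 < l"
  defines "R \<equiv> \<i> * of_real l * g / (g + \<i> * of_real l)"
  shows "0 \<le> Im R" "Im R \<le> l" "Im R \<le> (cmod g)\<^sup>2 / l + Im g" "cmod (g - R) \<le> (cmod g)\<^sup>2 / l"
proof -
  let ?n = "(cmod g)\<^sup>2 + 2 * l * Im g + l\<^sup>2"
  have n: "(cmod (g + \<i> * of_real l))\<^sup>2 = ?n"
    unfolding cmod_power2 by (simp add: power2_eq_square algebra_simps)
  have n_ge: "l\<^sup>2 \<le> ?n" using g l by simp
  have n_pos: "0 < ?n" using g l by (simp add: add_nonneg_pos)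
  have nz: "g + \<i> * of_real l \<noteq> 0" using n n_pos by auto
  have ImR: "Im R = l * ((cmod g)\<^sup>2 + l * Im g) / ?n"
  proof -
    have "Im (\<i> * of_real l * g * cnj (g + \<i> * of_real l)) = l * ((cmod g)\<^sup>2 + l * Im g)"
      unfolding cmod_power2 by (simp add: power2_eq_square algebra_simps)
    then show ?thesis
      unfolding R_def complex_div_cnj[of "\<i> * of_real l * g"] n Im_divide_of_real by simp
  qed
  show "0 \<le> Im R" unfolding ImR using g l n_pos by auto
  show "Im R \<le> l"
    unfolding ImR using g l n_pos by (simp add: divide_le_eq mult_left_mono)
  have "l * ((cmod g)\<^sup>2 + l * Im g) / ?n \<le> l * ((cmod g)\<^sup>2 + l * Im g) / l\<^sup>2"
    using g l n_pos n_ge by (intro divide_left_mono) auto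
  also have "\<dots> = (cmod g)\<^sup>2 / l + Im g"
    using l by (simp add: field_simps power2_eq_square)
  finally show "Im R \<le> (cmod g)\<^sup>2 / l + Im g" unfolding ImR .
  have "g - R = g\<^sup>2 / (g + \<i> * of_real l)"
    unfolding R_def using nz by (simp add: field_simps power2_eq_square)
  moreover have "l \<le> cmod (g + \<i> * of_real l)"
    using abs_Im_le_cmod[of "g + \<i> * of_real l"] g l by simp
  ultimately show "cmod (g - R) \<le> (cmod g)\<^sup>2 / l"
    using l by (simp add: norm_divide norm_power frac_le)
qed

text \<open>
  By Tonelli it suffices to bound the weighted integral of the Poisson kernel centred at one point \<open>s\<close> of
  the support; it is at least the contribution of \<open>[s - y, s + y]\<close>, where the weight is at least
  \<open>(r / 2)\<^sup>2\<close> and the kernel at least \<open>1 / (2 y)\<close>.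
\<close>

lemma weighted_Im_transform_lower_bound:
  fixes a b r y :: real
  assumes \<nu>: "finite_cauchy_integrable \<nu>"
    and conc: "AE s in \<nu>. s \<in> {a + r..b - r}" and r: "0 < r" and y: "0 < y" "y \<le> r / 2"
  shows "measure \<nu> UNIV * r\<^sup>2 / 4
    \<le> integral {a..b} (\<lambda>x. (x - a) * (b - x) * Im (borel_transform \<nu> (Complex x y)))"
proof -
  interpret finite_cauchy_integrable \<nu> by fact
  let ?g = "borel_transform \<nu>"
  let ?q = "\<lambda>x. (x - a) * (b - x)"
  let ?P = "\<lambda>x s. y / ((s - x)\<^sup>2 + y\<^sup>2)"
  have Im_g: "ennreal (Im (?g (Complex x y))) = (\<integral>\<^sup>+s. ennreal (?P x s) \<partial>\<nu>)" for x
    using y by (simp add: Im_borel_transform_ennreal cmod_power2)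
  have cont: "continuous_on {a..b} (\<lambda>x. ?q x * Im (?g (Complex x y)))"
    by (intro continuous_intros continuous_on_horizontal_line[OF holomorphic_borel_transform y(1)])
  have inner: "ennreal (r\<^sup>2 / 4) \<le> (\<integral>\<^sup>+x. ennreal (?q x) * indicator {a..b} x * ennreal (?P x s) \<partial>lborel)"
    if s: "s \<in> {a + r..b - r}" for s
  proof -
    have "ennreal (r\<^sup>2 / 4) = ennreal (r\<^sup>2 / (8 * y)) * ennreal (2 * y)"
      using y by (simp add: ennreal_mult[symmetric])
    also have "\<dots> = (\<integral>\<^sup>+x. ennreal (r\<^sup>2 / (8 * y)) * indicator {s - y..s + y} x \<partial>lborel)"
      using y by (simp add: nn_integral_cmult_indicator)
    also have "\<dots> \<le> (\<integral>\<^sup>+x. ennreal (?q x) * indicator {a..b} x * ennreal (?P x s) \<partial>lborel)"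
    proof (rule nn_integral_mono)
      fix x
      show "ennreal (r\<^sup>2 / (8 * y)) * indicator {s - y..s + y} x
          \<le> ennreal (?q x) * indicator {a..b} x * ennreal (?P x s)"
      proof (cases "x \<in> {s - y..s + y}")
        case True
        then have x: "r / 2 \<le> x - a" "r / 2 \<le> b - x" using s y by auto
        have q: "r / 2 * (r / 2) \<le> ?q x" by (rule mult_mono) (use x r in auto)
        have "(s - x)\<^sup>2 \<le> y\<^sup>2" using True by (intro abs_le_square_iff[THEN iffD1]) auto
        then have "y / (2 * y\<^sup>2) \<le> ?P x s"
          using y by (intro divide_left_mono) (auto intro!: mult_pos_pos add_nonneg_pos)
        then have P: "1 / (2 * y) \<le> ?P x s" using y by (simp add: power2_eq_square)
        have "r\<^sup>2 / (8 * y) = r / 2 * (r / 2) * (1 / (2 * y))" by (simp add: power2_eq_square)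
        also have "\<dots> \<le> ?q x * ?P x s"
          by (rule mult_mono[OF q P]) (use x r y in auto)
        finally have "ennreal (r\<^sup>2 / (8 * y)) \<le> ennreal (?q x * ?P x s)" by (rule ennreal_leI)
        also have "\<dots> = ennreal (?q x) * ennreal (?P x s)"
          using x r y by (intro ennreal_mult) auto
        finally show ?thesis using True x r by auto
      qed simp
    qed
    finally show ?thesis .
  qed
  have q_nonneg: "0 \<le> ?q x" if "x \<in> {a..b}" for x using that by simp
  interpret pair_sigma_finite lborel \<nu> ..
  have "ennreal (measure \<nu> UNIV * r\<^sup>2 / 4) = (\<integral>\<^sup>+s. ennreal (r\<^sup>2 / 4) \<partial>\<nu>)"
    by (simp add: emeasure_eq_measure ennreal_mult[symmetric] mult.commute)
  also have "\<dots> \<le> (\<integral>\<^sup>+s. (\<integral>\<^sup>+x. ennreal (?q x) * indicator {a..b} x * ennreal (?P x s) \<partial>lborel) \<partial>\<nu>)"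
    by (rule nn_integral_mono_AE) (use conc inner in \<open>auto elim: eventually_mono\<close>)
  also have "\<dots> = (\<integral>\<^sup>+x. (\<integral>\<^sup>+s. ennreal (?q x) * indicator {a..b} x * ennreal (?P x s) \<partial>\<nu>) \<partial>lborel)"
    by (rule Fubini') measurable
  also have "\<dots> = (\<integral>\<^sup>+x\<in>{a..b}. ennreal (?q x * Im (?g (Complex x y))) \<partial>lborel)"
  proof (rule nn_integral_cong)
    fix x
    have "(\<integral>\<^sup>+s. ennreal (?q x) * indicator {a..b} x * ennreal (?P x s) \<partial>\<nu>)
        = ennreal (?q x) * indicator {a..b} x * ennreal (Im (?g (Complex x y)))"
      unfolding Im_g by (rule nn_integral_cmult) measurable
    also have "\<dots> = ennreal (?q x * Im (?g (Complex x y))) * indicator {a..b} x"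
      using q_nonneg[of x] Im_borel_transform_nonneg[of "Complex x y"] y
      by (auto split: split_indicator simp: ennreal_mult)
    finally show "(\<integral>\<^sup>+s. ennreal (?q x) * indicator {a..b} x * ennreal (?P x s) \<partial>\<nu>) = \<dots>" .
  qed
  also have "\<dots> = ennreal (integral {a..b} (\<lambda>x. ?q x * Im (?g (Complex x y))))"
    by (rule nn_integral_continuous_interval[OF cont])
      (intro mult_nonneg_nonneg Im_borel_transform_nonneg, use y in auto)
  finally show ?thesis
    by (subst (asm) ennreal_le_iff)
      (auto intro!: Henstock_Kurzweil_Integration.integral_nonneg integrable_continuous_real cont
        mult_nonneg_nonneg Im_borel_transform_nonneg simp: y)
qed

lemma (in finite_cauchy_integrable) Im_borel_transform_le:
  assumes y: "0 < y" and \<rho>: "0 < \<rho>" and far: "AE s in \<nu>. \<rho> \<le> \<bar>s - x\<bar>"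
  shows "Im (borel_transform \<nu> (Complex x y)) \<le> measure \<nu> UNIV * y / \<rho>\<^sup>2"
proof -
  have "Im (borel_transform \<nu> (Complex x y)) = (LINT s|\<nu>. y / ((s - x)\<^sup>2 + y\<^sup>2))"
    using y by (simp add: Im_borel_transform cmod_power2)
  also have "\<dots> \<le> (LINT s|\<nu>. y / \<rho>\<^sup>2)"
  proof (rule integral_mono_AE)
    show "integrable \<nu> (\<lambda>s. y / ((s - x)\<^sup>2 + y\<^sup>2))"
      using integrable_poisson[of "Complex x y"] y by (simp add: cmod_power2)
    show "AE s in \<nu>. y / ((s - x)\<^sup>2 + y\<^sup>2) \<le> y / \<rho>\<^sup>2"
      using far
    proof eventually_elim
      case (elim s)
      then have "\<rho>\<^sup>2 \<le> (s - x)\<^sup>2" using \<rho> by (intro abs_le_square_iff[THEN iffD1]) auto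
      then have "\<rho>\<^sup>2 \<le> (s - x)\<^sup>2 + y\<^sup>2" by (simp add: add_increasing2)
      then show ?case using y \<rho> by (intro divide_left_mono) (auto intro!: mult_pos_pos add_nonneg_pos)
    qed
  qed simp
  also have "\<dots> = measure \<nu> UNIV * y / \<rho>\<^sup>2" by simp
  finally show ?thesis .
qed

text \<open>
  Truncation at a high level \<open>l\<close> loses at most half of the mass seen in the weighted integral, however
  singular the measure is: the difference of the transform and its truncation is \<open>O(1 / l)\<close> on the three
  sides of the rectangle away from the support, hence, by holomorphy, its weighted integral over the lower
  side is \<open>O(1 / l)\<close> too.
\<close>

lemma truncated_transform_lower_bound:
  fixes a b r :: real
  assumes \<nu>: "finite_cauchy_integrable \<nu>" and conc: "AE s in \<nu>. s \<in> {a + r..b - r}"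
    and r: "0 < r" "r \<le> 1" and ab: "a < b"
  shows "\<exists>l\<^sub>0>0. \<forall>l\<ge>l\<^sub>0. \<forall>y. 0 < y \<and> y \<le> r / 2 \<longrightarrow>
    ennreal (measure \<nu> UNIV * r\<^sup>2 / 8)
      \<le> (\<integral>\<^sup>+x\<in>{a..b}. ennreal ((x - a) * (b - x) *
            Im (\<i> * of_real l * borel_transform \<nu> (Complex x y) / (borel_transform \<nu> (Complex x y) + \<i> * of_real l))) \<partial>lborel)"
proof (cases "measure \<nu> UNIV = 0")
  case True
  then show ?thesis by (auto intro: exI[of _ 1])
next
  case False
  then have pos: "0 < measure \<nu> UNIV" by (simp add: zero_less_measure_iff)
  interpret finite_cauchy_integrable \<nu> by fact
  let ?m = "measure \<nu> UNIV" and ?g = "borel_transform \<nu>"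
  let ?q = "\<lambda>x. (x - a) * (b - x)"
  define A where "A = ?m / r"
  define C where "C = (b - a + 2) * ((b - a + 1)\<^sup>2 * A\<^sup>2)"
  have A: "0 < A" using pos r by (simp add: A_def)
  have C: "0 < C" using A ab by (simp add: C_def)
  define l\<^sub>0 where "l\<^sub>0 = C / (?m * r\<^sup>2 / 8)"
  have l0: "0 < l\<^sub>0" using C pos r by (simp add: l\<^sub>0_def)
  have "ennreal (?m * r\<^sup>2 / 8)
      \<le> (\<integral>\<^sup>+x\<in>{a..b}. ennreal (?q x * Im (\<i> * of_real l * ?g (Complex x y) / (?g (Complex x y) + \<i> * of_real l))) \<partial>lborel)"
    if l: "l\<^sub>0 \<le> l" and y: "0 < y" "y \<le> r / 2" for l y
  proof -
    have l_pos: "0 < l" using l l0 by linarith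
    define R where "R z = \<i> * of_real l * ?g z / (?g z + \<i> * of_real l)" for z
    have R: "0 \<le> Im (R z)" "cmod (?g z - R z) \<le> (cmod (?g z))\<^sup>2 / l" if "Im z > 0" for z
      using truncation_bounds(1,4)[OF Im_borel_transform_nonneg[OF that] l_pos] by (auto simp: R_def)
    have nz: "?g z + \<i> * of_real l \<noteq> 0" if "Im z > 0" for z
      using Im_borel_transform_nonneg[OF that] l_pos by (auto simp: complex_eq_iff)
    have holR: "R holomorphic_on {z. Im z > 0}"
      unfolding R_def by (intro holomorphic_intros holomorphic_borel_transform) (auto simp: nz)
    have holD: "(\<lambda>z. ?g z - R z) holomorphic_on {z. Im z > 0}"
      by (intro holomorphic_intros holomorphic_borel_transform holR)
    have contR: "continuous_on {a..b} (\<lambda>x. ?q x * Im (R (Complex x y)))"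
      by (intro continuous_intros continuous_on_horizontal_line[OF holR y(1)])
    have contg: "continuous_on {a..b} (\<lambda>x. ?q x * Im (?g (Complex x y)))"
      by (intro continuous_intros continuous_on_horizontal_line[OF holomorphic_borel_transform y(1)])
    have "integral {a..b} (\<lambda>x. ?q x * Im (?g (Complex x y))) - integral {a..b} (\<lambda>x. ?q x * Im (R (Complex x y)))
        = integral {a..b} (\<lambda>x. ?q x * Im (?g (Complex x y) - R (Complex x y)))"
    proof -
      have "(\<lambda>x. ?q x * Im (?g (Complex x y) - R (Complex x y)))
          = (\<lambda>x. ?q x * Im (?g (Complex x y)) - ?q x * Im (R (Complex x y)))"
        by (simp add: fun_eq_iff algebra_simps)
      then show ?thesis
        using Henstock_Kurzweil_Integration.integral_diff[OF integrable_continuous_real[OF contg]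
            integrable_continuous_real[OF contR]] by simp
    qed
    also have "\<dots> = Im (integral {a..b} (\<lambda>x. of_real (?q x) * (?g (Complex x y) - R (Complex x y))))"
      by (rule Im_weighted_integral[OF holD y(1), symmetric])
    also have "\<dots> \<le> cmod (integral {a..b} (\<lambda>x. of_real (?q x) * (?g (Complex x y) - R (Complex x y))))"
      by (rule order_trans[OF abs_ge_self abs_Im_le_cmod])
    also have "\<dots> \<le> (b - a + 2) * ((b - a + 1)\<^sup>2 * (A\<^sup>2 / l))"
    proof (rule rectangle_bound[OF holD ab y(1)])
      fix z assume z: "a \<le> Re z" "Re z \<le> b" "0 \<le> Im z" "Im z \<le> 1" "Re z = a \<or> Re z = b \<or> Im z = 1"
      let ?z = "z + \<i> * of_real y"
      have Im_z: "0 < Im ?z" using z y by simp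
      have "cmod (?g ?z) \<le> ?m / r"
      proof (rule cmod_borel_transform_le[OF Im_z r(1)])
        show "AE s in \<nu>. r \<le> cmod (of_real s - ?z)"
          using conc
        proof eventually_elim
          case (elim s)
          show ?case
          proof (cases "Im z = 1")
            case True
            then show ?thesis using Im_le_cmod_of_real_diff[of ?z s] r y by simp
          next
            case False
            then have "r \<le> \<bar>Re (of_real s - ?z)\<bar>" using elim z by auto
            then show ?thesis using abs_Re_le_cmod[of "of_real s - ?z"] by linarith
          qed
        qed
      qed
      then have "(cmod (?g ?z))\<^sup>2 \<le> A\<^sup>2" unfolding A_def by (intro power_mono) auto
      then have "(cmod (?g ?z))\<^sup>2 / l \<le> A\<^sup>2 / l" using l_pos by (simp add: divide_right_mono)
      then have D: "cmod (?g ?z - R ?z) \<le> A\<^sup>2 / l" using R(2)[OF Im_z] by linarith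
      have za: "cmod (z - of_real a) \<le> b - a + 1"
        by (rule order_trans[OF cmod_le]) (use z in auto)
      have zb: "cmod (of_real b - z) \<le> b - a + 1"
        by (rule order_trans[OF cmod_le]) (use z in auto)
      show "cmod ((z - of_real a) * (of_real b - z) * (?g ?z - R ?z)) \<le> (b - a + 1)\<^sup>2 * (A\<^sup>2 / l)"
        unfolding norm_mult power2_eq_square[of "b - a + 1"]
        by (intro mult_mono za zb D) (use ab in auto)
    qed
    also have "\<dots> = C / l" by (simp add: C_def)
    also have "\<dots> \<le> C / l\<^sub>0" using l l0 C by (intro divide_left_mono) auto
    also have "\<dots> = ?m * r\<^sup>2 / 8" using C by (simp add: l\<^sub>0_def)
    finally have "?m * r\<^sup>2 / 8 \<le> integral {a..b} (\<lambda>x. ?q x * Im (R (Complex x y)))"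
      using weighted_Im_transform_lower_bound[OF \<nu> conc r(1) y] by linarith
    then have "ennreal (?m * r\<^sup>2 / 8) \<le> ennreal (integral {a..b} (\<lambda>x. ?q x * Im (R (Complex x y))))"
      by (rule ennreal_leI)
    also have "\<dots> = (\<integral>\<^sup>+x\<in>{a..b}. ennreal (?q x * Im (R (Complex x y))) \<partial>lborel)"
      by (rule nn_integral_continuous_interval[OF contR, symmetric])
        (intro mult_nonneg_nonneg R, use y in auto)
    finally show ?thesis unfolding R_def .
  qed
  with l0 show ?thesis by blast
qed

text \<open>
  Compare with the truncation \<open>R\<close> of \<open>g\<close> at level \<open>l\<close>, which keeps a fixed amount \<open>c\<^sub>0\<close> of mass. On
  \<open>B\<close> and on a neighbourhood \<open>U\<close> of \<open>K\<close> of measure at most \<open>d\<close>, \<open>Im R \<le> l\<close> allows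
  only a mass of order \<open>l d\<close>. Elsewhere \<open>Im R \<le> \<bar>g\<bar>\<^sup>2 / l + Im g\<close>, and \<open>Im g\<close> is small there for small \<open>y\<close>,
  because \<open>K\<close> carries the measure. With \<open>l\<close> a small multiple of \<open>1 / d\<close>, a fixed part of \<open>c\<^sub>0\<close> must
  therefore come from \<open>\<bar>g\<bar>\<^sup>2 / l\<close>. Such a \<open>U\<close> exists because \<open>K\<close> is a null set.
\<close>

lemma energy_blowup_interior:
  fixes a b :: real
  assumes \<nu>: "finite_cauchy_integrable \<nu>" and K: "compact K" "K \<subseteq> {a<..<b}" "K \<in> null_sets lborel"
    and conc: "AE s in \<nu>. s \<in> K" and pos: "0 < measure \<nu> UNIV"
  shows "energy_blowup a b (borel_transform \<nu>)"
proof -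
  interpret finite_cauchy_integrable \<nu> by fact
  let ?m = "measure \<nu> UNIV" and ?g = "borel_transform \<nu>"
  let ?q = "\<lambda>x. (x - a) * (b - x)"
  have "K \<noteq> {}"
  proof
    assume "K = {}"
    then have "emeasure \<nu> (space \<nu>) = 0" using conc by (simp add: AE_iff_measurable[of UNIV])
    then show False using pos by (simp add: measure_def)
  qed
  then obtain p q where pq: "p \<in> K" "q \<in> K" "\<And>s. s \<in> K \<Longrightarrow> p \<le> s \<and> s \<le> q"
    using compact_attains_inf[OF K(1)] compact_attains_sup[OF K(1)] by metis
  define r where "r = min 1 (min (p - a) (b - q))"
  have r: "0 < r" "r \<le> 1" using pq K(2) by (auto simp: r_def)
  have ab: "a < b" using pq(1) K(2) by auto
  have "K \<subseteq> {a + r..b - r}" using pq by (force simp: r_def)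
  then have conc_r: "AE s in \<nu>. s \<in> {a + r..b - r}"
    by (intro eventually_mono[OF conc]) (rule subsetD)
  have "\<exists>l\<^sub>0>0. \<forall>l\<ge>l\<^sub>0. \<forall>y. 0 < y \<and> y \<le> r / 2 \<longrightarrow>
    ennreal (?m * r\<^sup>2 / 8) \<le> (\<integral>\<^sup>+x\<in>{a..b}. ennreal (?q x *
        Im (\<i> * of_real l * ?g (Complex x y) / (?g (Complex x y) + \<i> * of_real l))) \<partial>lborel)"
    (is "\<exists>l\<^sub>0>0. ?lower l\<^sub>0")
    by (rule truncated_transform_lower_bound[OF \<nu> conc_r r ab])
  then obtain l\<^sub>0 where l0: "0 < l\<^sub>0" and lower: "?lower l\<^sub>0" by (elim exE conjE)
  define c\<^sub>0 where "c\<^sub>0 = ?m * r\<^sup>2 / 8"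
  define Q where "Q = (b - a)\<^sup>2"
  have c0: "0 < c\<^sub>0" using pos r by (simp add: c\<^sub>0_def)
  have Q: "0 < Q" using ab by (simp add: Q_def)
  have q_le: "0 \<le> ?q x" "?q x \<le> Q" if "x \<in> {a..b}" for x
    using that unfolding Q_def power2_eq_square by (auto intro!: mult_mono)
  have "\<exists>y\<^sub>0>0. \<forall>y. 0 < y \<and> y < y\<^sub>0 \<longrightarrow> (\<forall>B\<in>sets borel. emeasure lborel B \<le> ennreal d \<longrightarrow>
      ennreal (c\<^sub>0\<^sup>2 / (16 * Q\<^sup>2) / d) \<le> (\<integral>\<^sup>+x\<in>{a..b} - B. ennreal ((cmod (?g (Complex x y)))\<^sup>2) \<partial>lborel))"
    if d: "0 < d" "d \<le> c\<^sub>0 / (8 * Q * l\<^sub>0)" for d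
  proof -
    \<comment> \<open>This level makes the contribution \<open>2 Q l d\<close> of \<open>B \<union> U\<close> equal to \<open>c\<^sub>0 / 4\<close>.\<close>
    define l where "l = c\<^sub>0 / (8 * Q * d)"
    have l_pos: "0 < l" using c0 Q d by (simp add: l_def)
    have l: "l\<^sub>0 \<le> l" using d l0 Q by (simp add: l_def field_simps)
    obtain U where U: "open U" "K \<subseteq> U" "emeasure lborel (U - K) < ennreal d"
      using outer_regular_lborel[OF _ d(1), of K] K(3) by (metis null_setsD2 sets_lborel)
    have "emeasure lborel U \<le> emeasure lborel (U - K) + emeasure lborel K"
      by (rule order_trans[OF emeasure_mono emeasure_subadditive]) (use U K in auto)
    then have U_small: "emeasure lborel U \<le> ennreal d" using U K(3) by auto
    obtain \<rho> where \<rho>: "0 < \<rho>" "\<And>s x. s \<in> K \<Longrightarrow> x \<notin> U \<Longrightarrow> \<rho> \<le> \<bar>s - x\<bar>"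
    proof -
      have "closed (- U)" "K \<inter> - U = {}" using U by auto
      then obtain \<delta> where "0 < \<delta>" "\<forall>s\<in>K. \<forall>x\<in>- U. \<delta> \<le> dist s x"
        using separate_compact_closed[OF K(1), of "- U"] by blast
      then show ?thesis by (intro that[of \<delta>]) (auto simp: dist_real_def)
    qed
    \<comment> \<open>The second bound on \<open>y\<close> makes the contribution of \<open>Im g\<close> outside \<open>U\<close> at most \<open>c\<^sub>0 / 4\<close>.\<close>
    define y\<^sub>0 where "y\<^sub>0 = min (r / 2) (c\<^sub>0 * \<rho>\<^sup>2 / (4 * Q * ?m * (b - a)))"
    have y0: "0 < y\<^sub>0" using r c0 \<rho> Q pos ab by (simp add: y\<^sub>0_def)
    have main: "ennreal (c\<^sub>0\<^sup>2 / (16 * Q\<^sup>2) / d) \<le> (\<integral>\<^sup>+x\<in>{a..b} - B. ennreal ((cmod (?g (Complex x y)))\<^sup>2) \<partial>lborel)"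
      if y: "0 < y" "y < y\<^sub>0" and B: "B \<in> sets borel" "emeasure lborel B \<le> ennreal d" for y B
    proof (cases "(\<integral>\<^sup>+x\<in>{a..b} - B. ennreal ((cmod (?g (Complex x y)))\<^sup>2) \<partial>lborel)")
      case (real X)
      define R where "R z = \<i> * of_real l * ?g z / (?g z + \<i> * of_real l)" for z
      define e where "e = ?m * y / \<rho>\<^sup>2"
      have e: "0 \<le> e" using pos y by (simp add: e_def)
      have meas: "(\<lambda>x. (cmod (?g (Complex x y)))\<^sup>2) \<in> borel_measurable borel"
        by (intro borel_measurable_continuous_onI continuous_intros
            continuous_on_horizontal_line[OF holomorphic_borel_transform y(1)])
      have "ennreal c\<^sub>0 \<le> (\<integral>\<^sup>+x\<in>{a..b}. ennreal (?q x * Im (R (Complex x y))) \<partial>lborel)"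
        unfolding c\<^sub>0_def R_def by (rule lower[rule_format, OF l]) (use y in \<open>simp add: y\<^sub>0_def\<close>)
      also have "\<dots> \<le> (\<integral>\<^sup>+x. ennreal (Q * l) * indicator (B \<union> U) x
          + ennreal (Q / l) * (ennreal ((cmod (?g (Complex x y)))\<^sup>2) * indicator ({a..b} - B) x)
          + ennreal (Q * e) * indicator {a..b} x \<partial>lborel)"
      proof (rule nn_integral_mono)
        fix x
        let ?z = "Complex x y"
        have Im_z: "0 < Im ?z" using y by simp
        note tb = truncation_bounds[OF Im_borel_transform_nonneg[OF Im_z] l_pos, folded R_def]
        show "ennreal (?q x * Im (R ?z)) * indicator {a..b} x
          \<le> ennreal (Q * l) * indicator (B \<union> U) x
          + ennreal (Q / l) * (ennreal ((cmod (?g ?z))\<^sup>2) * indicator ({a..b} - B) x)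
          + ennreal (Q * e) * indicator {a..b} x"
        proof (cases "x \<in> {a..b}")
          case x: True
          show ?thesis
          proof (cases "x \<in> B \<union> U")
            case True
            have "?q x * Im (R ?z) \<le> Q * l"
              by (rule mult_mono) (use q_le[OF x] tb Q in auto)
            then have "ennreal (?q x * Im (R ?z)) \<le> ennreal (Q * l)" by (rule ennreal_leI)
            with x True show ?thesis by (simp add: add_increasing2)
          next
            case False
            have "AE s in \<nu>. \<rho> \<le> \<bar>s - x\<bar>"
              using conc by eventually_elim (use False \<rho> in auto)
            then have "Im (?g ?z) \<le> e"
              unfolding e_def by (rule Im_borel_transform_le[OF y(1) \<rho>(1)])
            with tb(3) have "Im (R ?z) \<le> (cmod (?g ?z))\<^sup>2 / l + e" by linarith
            then have "?q x * Im (R ?z) \<le> Q * ((cmod (?g ?z))\<^sup>2 / l + e)"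
              by (intro mult_mono) (use q_le[OF x] tb Q in auto)
            also have "\<dots> = Q / l * (cmod (?g ?z))\<^sup>2 + Q * e" by (simp add: algebra_simps)
            finally have "ennreal (?q x * Im (R ?z)) \<le> ennreal (Q / l * (cmod (?g ?z))\<^sup>2 + Q * e)"
              by (rule ennreal_leI)
            also have "\<dots> = ennreal (Q / l) * ennreal ((cmod (?g ?z))\<^sup>2) + ennreal (Q * e)"
              using Q l_pos e by (subst ennreal_plus) (auto simp: ennreal_mult simp del: times_divide_eq_left)
            finally show ?thesis using x False by simp
          qed
        qed simp
      qed
      also have "\<dots> = ennreal (Q * l) * emeasure lborel (B \<union> U) + ennreal (Q / l) * ennreal X
          + ennreal (Q * e) * ennreal (b - a)"
      proof -
        note [measurable] = meas B(1) borel_open[OF U(1)]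
        show ?thesis
          unfolding real(2)[symmetric]
          by (subst nn_integral_add, measurable, subst nn_integral_add, measurable, subst nn_integral_cmult, measurable)
            (use ab in \<open>simp add: nn_integral_cmult_indicator\<close>)
      qed
      also have "\<dots> \<le> ennreal (Q * l) * ennreal (2 * d) + ennreal (Q / l) * ennreal X
          + ennreal (Q * e) * ennreal (b - a)"
      proof (intro add_right_mono mult_left_mono)
        have "emeasure lborel (B \<union> U) \<le> emeasure lborel B + emeasure lborel U"
          by (rule emeasure_subadditive) (use B U in auto)
        also have "\<dots> \<le> ennreal d + ennreal d" by (intro add_mono B U_small)
        also have "\<dots> = ennreal (2 * d)" using d by (simp flip: ennreal_plus)
        finally show "emeasure lborel (B \<union> U) \<le> ennreal (2 * d)" .
      qed simp
      also have "\<dots> = ennreal (Q * l * (2 * d) + Q / l * X + Q * e * (b - a))"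
      proof -
        have "ennreal (p * p' + q * q' + s * s') = ennreal p * ennreal p' + ennreal q * ennreal q' + ennreal s * ennreal s'"
          if "0 \<le> p" "0 \<le> p'" "0 \<le> q" "0 \<le> q'" "0 \<le> s" "0 \<le> s'" for p p' q q' s s'
          using that by (simp add: ennreal_mult)
        note * = this
        show ?thesis by (rule *[symmetric]) (use Q l_pos d e ab real in auto)
      qed
      finally have "c\<^sub>0 \<le> Q * l * (2 * d) + Q / l * X + Q * e * (b - a)"
        using Q l_pos d e ab real by (subst (asm) ennreal_le_iff) auto
      moreover have "Q * l * (2 * d) = c\<^sub>0 / 4" using Q d by (simp add: l_def field_simps)
      moreover have "Q * e * (b - a) \<le> c\<^sub>0 / 4"
      proof -
        have "y \<le> c\<^sub>0 * \<rho>\<^sup>2 / (4 * Q * ?m * (b - a))" using y by (simp add: y\<^sub>0_def)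
        then have "y * (4 * Q * ?m * (b - a)) \<le> c\<^sub>0 * \<rho>\<^sup>2" using Q pos ab by (simp add: le_divide_eq)
        then show ?thesis using \<rho> by (simp add: e_def field_simps)
      qed
      ultimately have "c\<^sub>0 / 2 \<le> Q / l * X" by linarith
      then have "c\<^sub>0 / 2 * (l / Q) \<le> Q / l * X * (l / Q)"
        using Q l_pos by (intro mult_right_mono) auto
      then have "c\<^sub>0\<^sup>2 / (16 * Q\<^sup>2) / d \<le> X"
        using Q l_pos d by (simp add: l_def power2_eq_square field_simps)
      then show ?thesis unfolding real by (rule ennreal_leI)
    qed simp
    with y0 show ?thesis by blast
  qed
  moreover have "0 < c\<^sub>0\<^sup>2 / (16 * Q\<^sup>2)" "0 < c\<^sub>0 / (8 * Q * l\<^sub>0)" using c0 Q l0 by auto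
  ultimately show ?thesis unfolding energy_blowup_def by blast
qed

section \<open>From the energy estimates to the distribution function\<close>

text \<open>
  One-sided means are used because the differentiation theorem for Henstock-Kurzweil integrals is about
  intervals with left end point \<open>x\<close>.
\<close>

lemma lebesgue_differentiation_AE:
  fixes u :: "real \<Rightarrow> real"
  assumes [measurable]: "u \<in> borel_measurable borel" and bdd: "\<And>x. \<bar>u x\<bar> \<le> C"
  shows "AE x in lborel. \<forall>e>0. \<exists>d>0. \<forall>h. 0 < h \<and> h < d \<longrightarrow> \<bar>integral {x..x + h} u / h - u x\<bar> < e"
proof -
  have "u integrable_on cbox c d" for c d
    using set_borel_integral_eq_integral(1)[OF bounded_set_integrable_Icc[OF assms]] by simp
  then obtain N where N: "negligible N"
      "\<And>x e. x \<notin> N \<Longrightarrow> 0 < e \<Longrightarrow> \<exists>d>0. \<forall>h. 0 < h \<and> h < d \<longrightarrow>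
          norm (integral (cbox x (x + h *\<^sub>R One)) u /\<^sub>R h ^ DIM(real) - u x) < e"
    using integrable_ccontinuous_explicit[of u] by blast
  have "AE x in lebesgue. x \<notin> N"
    using N(1) by (simp add: negligible_iff_null_sets AE_not_in)
  then have "AE x in lborel. x \<notin> N" by (simp add: AE_completion_iff)
  then show ?thesis
    by eventually_elim (use N(2) in \<open>simp add: divide_inverse_commute\<close>)
qed

text \<open>
  Write \<open>D(t)\<close> for the measure of \<open>{x \<in> [a, b]. w x < t}\<close>. By the layer cake formula the bound on
  \<open>\<integral> g\<^sub>n h\<^sub>n\<close> bounds \<open>\<integral> \<Phi>\<^sub>n(t) dt\<close>, where \<open>\<Phi>\<^sub>n(t)\<close> is the integral of \<open>g\<^sub>n\<close> over
  \<open>{x \<in> [a, b]. t < h\<^sub>n x}\<close>. The removed set \<open>{h\<^sub>n \<le> t}\<close> is eventually contained in \<open>{w < t}\<close> up to small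
  measure, so \<open>\<Phi>\<^sub>n(t) \<ge> c / d\<close> eventually for every \<open>d > D(t)\<close>, and Fatou's lemma finishes the proof.
  Levels with \<open>D(t) \<ge> d\<^sub>0\<close> contribute at most \<open>\<delta> / d\<^sub>0\<close>.
\<close>

lemma distribution_integral_finite:
  fixes h g :: "nat \<Rightarrow> real \<Rightarrow> ennreal" and w :: "real \<Rightarrow> real" and c d\<^sub>0 \<delta> a b :: real
  assumes h [measurable]: "\<And>n. h n \<in> borel_measurable borel"
    and g [measurable]: "\<And>n. g n \<in> borel_measurable borel"
    and w [measurable]: "w \<in> borel_measurable borel"
    and c: "0 < c" and d0: "0 < d\<^sub>0" and \<delta>: "0 < \<delta>"
    and exceed: "\<And>t. 0 < t \<Longrightarrow> t \<le> \<delta> \<Longrightarrow>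
        AE x in lborel. x \<in> {a..b} \<longrightarrow> t \<le> w x \<longrightarrow> (\<forall>\<^sub>F n in sequentially. ennreal t < h n x)"
    and blowup: "\<And>d. 0 < d \<Longrightarrow> d \<le> d\<^sub>0 \<Longrightarrow> \<forall>\<^sub>F n in sequentially.
        \<forall>B\<in>sets borel. emeasure lborel B \<le> ennreal d \<longrightarrow> ennreal (c / d) \<le> (\<integral>\<^sup>+x\<in>{a..b} - B. g n x \<partial>lborel)"
    and bound: "\<And>n. (\<integral>\<^sup>+x\<in>{a..b}. g n x * h n x \<partial>lborel) \<le> C" and C: "C < \<infinity>"
  shows "(\<integral>\<^sup>+ y\<in>{0..\<delta>}. 1 / distribution_fun {a..b} w y \<partial>lborel) < \<infinity>"
proof -
  define \<Phi> where "\<Phi> n t = (\<integral>\<^sup>+x. g n x * indicator {a..b} x * indicator {x. ennreal t < h n x} x \<partial>lborel)" for n t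
  have meas_less [measurable]: "(\<lambda>p. indicator {x. ennreal (fst p) < h n x} (snd p) :: ennreal)
      \<in> borel_measurable (borel \<Otimes>\<^sub>M borel)" for n
  proof -
    have "(\<lambda>p. indicator {p. ennreal (fst p) < h n (snd p)} p :: ennreal) \<in> borel_measurable (borel \<Otimes>\<^sub>M borel)"
      by measurable
    moreover have "(\<lambda>p. indicator {p. ennreal (fst p) < h n (snd p)} p :: ennreal)
        = (\<lambda>p. indicator {x. ennreal (fst p) < h n x} (snd p))"
      by (auto simp: indicator_def)
    ultimately show ?thesis by simp
  qed
  have meas_less' [measurable]: "{x. ennreal t < h n x} \<in> sets borel" for t n
    by measurable
  have \<Phi>_meas [measurable]: "\<Phi> n \<in> borel_measurable borel" for n
    unfolding \<Phi>_def
    by (rule lborel.borel_measurable_nn_integral) (simp add: case_prod_beta)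
  have layer: "(\<integral>\<^sup>+t. indicator {0..\<delta>} t * indicator {x. ennreal t < h n x} x \<partial>lborel) \<le> h n x" for n x
  proof (cases "h n x")
    case (real r)
    have "(\<integral>\<^sup>+t. indicator {0..\<delta>} t * indicator {x. ennreal t < h n x} x \<partial>lborel)
        \<le> (\<integral>\<^sup>+t. indicator {0..r} t \<partial>lborel)"
      by (intro nn_integral_mono) (auto simp: indicator_def real ennreal_less_iff)
    also have "\<dots> = ennreal r" using real by simp
    finally show ?thesis by (simp add: real)
  qed simp
  have \<Phi>_bound: "(\<integral>\<^sup>+t. indicator {0..\<delta>} t * \<Phi> n t \<partial>lborel) \<le> C" for n
  proof -
    have "(\<integral>\<^sup>+t. indicator {0..\<delta>} t * \<Phi> n t \<partial>lborel)
        = (\<integral>\<^sup>+t. (\<integral>\<^sup>+x. indicator {0..\<delta>} t * (g n x * indicator {a..b} x * indicator {x. ennreal t < h n x} x) \<partial>lborel) \<partial>lborel)"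
      unfolding \<Phi>_def by (simp add: nn_integral_cmult)
    also have "\<dots> = (\<integral>\<^sup>+x. (\<integral>\<^sup>+t. indicator {0..\<delta>} t * (g n x * indicator {a..b} x * indicator {x. ennreal t < h n x} x) \<partial>lborel) \<partial>lborel)"
      by (rule lborel_pair.Fubini'[symmetric]) (simp add: case_prod_beta)
    also have "\<dots> = (\<integral>\<^sup>+x. g n x * indicator {a..b} x * (\<integral>\<^sup>+t. indicator {0..\<delta>} t * indicator {x. ennreal t < h n x} x \<partial>lborel) \<partial>lborel)"
      by (subst nn_integral_cmult[symmetric]) (auto intro!: nn_integral_cong simp: mult_ac)
    also have "\<dots> \<le> (\<integral>\<^sup>+x. g n x * indicator {a..b} x * h n x \<partial>lborel)"
      by (intro nn_integral_mono mult_left_mono layer) simp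
    also have "\<dots> \<le> C" using bound[of n] by (simp add: mult_ac)
    finally show ?thesis .
  qed
  have \<Phi>_large: "ennreal (c / d) \<le> liminf (\<lambda>n. \<Phi> n t)"
    if t: "0 < t" "t \<le> \<delta>" and d: "0 < d" "d \<le> d\<^sub>0" and D: "distribution_fun {a..b} w t < ennreal d" for t d
  proof -
    let ?E = "\<lambda>n. {x \<in> {a..b}. t \<le> w x \<and> \<not> ennreal t < h n x}"
    let ?B = "\<lambda>n. {x \<in> {a..b}. \<not> ennreal t < h n x}"
    have "(\<lambda>n. \<integral>\<^sup>+x. indicator (?E n) x \<partial>lborel) \<longlonglongrightarrow> (\<integral>\<^sup>+x. 0 \<partial>(lborel :: real measure))"
    proof (rule nn_integral_dominated_convergence[where w = "indicator {a..b}"])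
      show "AE x in lborel. (\<lambda>n. indicator (?E n) x :: ennreal) \<longlonglongrightarrow> 0"
        using exceed[OF t]
      proof eventually_elim
        case (elim x)
        show ?case
        proof (cases "x \<in> {a..b} \<and> t \<le> w x")
          case True
          then have "\<forall>\<^sub>F n in sequentially. ennreal t < h n x" using elim by simp
          then have "\<forall>\<^sub>F n in sequentially. (indicator (?E n) x :: ennreal) = 0"
            by eventually_elim simp
          then show ?thesis by (rule tendsto_eventually)
        qed (auto intro: tendsto_eventually)
      qed
      show "(\<integral>\<^sup>+x. indicator {a..b} x \<partial>lborel) < \<infinity>"
        by (simp add: emeasure_lborel_Icc_eq)
    qed (auto split: split_indicator)
    then have E0: "(\<lambda>n. emeasure lborel (?E n)) \<longlonglongrightarrow> 0" by simp
    have "0 < ennreal d - distribution_fun {a..b} w t" using D by (simp add: diff_gr0_ennreal)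
    with E0 have "\<forall>\<^sub>F n in sequentially. emeasure lborel (?E n) < ennreal d - distribution_fun {a..b} w t"
      by (rule order_tendstoD)
    then have "\<forall>\<^sub>F n in sequentially. emeasure lborel (?B n) \<le> ennreal d"
    proof eventually_elim
      case (elim n)
      have "emeasure lborel (?B n) \<le> emeasure lborel (?E n \<union> {x \<in> {a..b}. w x < t})"
        by (rule emeasure_mono) auto
      also have "\<dots> \<le> emeasure lborel (?E n) + distribution_fun {a..b} w t"
        unfolding distribution_fun_def by (rule emeasure_subadditive) auto
      also have "\<dots> \<le> ennreal d - distribution_fun {a..b} w t + distribution_fun {a..b} w t"
        using elim by (intro add_right_mono less_imp_le)
      also have "\<dots> = ennreal d" using D by (intro diff_add_cancel_ennreal less_imp_le)
      finally show ?case .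
    qed
    then have "\<forall>\<^sub>F n in sequentially. ennreal (c / d) \<le> \<Phi> n t"
      using blowup[OF d]
    proof eventually_elim
      case (elim n)
      have "?B n \<in> sets borel" by measurable
      then have "ennreal (c / d) \<le> (\<integral>\<^sup>+x\<in>{a..b} - ?B n. g n x \<partial>lborel)" using elim by blast
      also have "\<dots> = \<Phi> n t"
        unfolding \<Phi>_def by (intro nn_integral_cong) (auto split: split_indicator)
      finally show ?case .
    qed
    then show ?thesis by (rule Liminf_bounded)
  qed
  have pointwise: "1 / distribution_fun {a..b} w t \<le> ennreal (1 / d\<^sub>0) + ennreal (1 / c) * liminf (\<lambda>n. \<Phi> n t)"
    if t: "0 < t" "t \<le> \<delta>" for t
  proof (cases "distribution_fun {a..b} w t < ennreal d\<^sub>0")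
    case False
    have "1 / distribution_fun {a..b} w t \<le> ennreal (1 / d\<^sub>0)"
    proof (cases "distribution_fun {a..b} w t")
      case (real r)
      then have "d\<^sub>0 \<le> r" using False by (simp add: ennreal_less_iff not_less)
      then have "1 / distribution_fun {a..b} w t = ennreal (1 / r)" "1 / r \<le> 1 / d\<^sub>0"
        using d0 real(2) by (auto simp: divide_ennreal frac_le simp flip: ennreal_1)
      then show ?thesis by (simp add: ennreal_leI)
    qed simp
    then show ?thesis by (simp add: add_increasing2)
  next
    case True
    then obtain D where D: "0 \<le> D" "distribution_fun {a..b} w t = ennreal D" "D < d\<^sub>0"
      by (cases "distribution_fun {a..b} w t") (auto simp: ennreal_less_iff)
    show ?thesis
    proof (cases "liminf (\<lambda>n. \<Phi> n t)")
      case (real L)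
      have le: "c / d \<le> L" if "D < d" "d \<le> d\<^sub>0" for d
        using \<Phi>_large[OF t, of d] that D real by (auto simp: ennreal_less_iff ennreal_le_iff2)
      have "0 < c / d\<^sub>0" using c d0 by simp
      then have L: "0 < L" using le[of d\<^sub>0] D by simp
      have "c / L \<le> D"
      proof (rule field_le_epsilon)
        fix e :: real assume e: "0 < e"
        define m where "m = min (D + e) d\<^sub>0"
        have m: "D < m" "m \<le> d\<^sub>0" "m \<le> D + e" using D e by (auto simp: m_def)
        have "c / m \<le> L" by (rule le[OF m(1,2)])
        then have "c / L \<le> m"
          using L m(1) D(1) by (simp add: divide_le_eq mult.commute)
        with m(3) show "c / L \<le> D + e" by linarith
      qed
      moreover from this have Dpos: "0 < D" using c L by (smt (verit) divide_pos_pos)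
      ultimately have "1 / D \<le> 1 / c * L" using c L by (simp add: field_simps)
      moreover have "1 / distribution_fun {a..b} w t = ennreal (1 / D)"
        using Dpos D by (simp add: divide_ennreal flip: ennreal_1)
      ultimately have "1 / distribution_fun {a..b} w t \<le> ennreal (1 / c * L)" by (simp add: ennreal_leI)
      also have "\<dots> = ennreal (1 / c) * ennreal L" by (rule ennreal_mult) (use c L in auto)
      finally show ?thesis unfolding real by (simp add: add_increasing)
    next
      case top
      then show ?thesis using c by (simp add: ennreal_mult_top)
    qed
  qed
  have "(\<integral>\<^sup>+ y\<in>{0..\<delta>}. 1 / distribution_fun {a..b} w y \<partial>lborel)
      \<le> (\<integral>\<^sup>+t. ennreal (1 / d\<^sub>0) * indicator {0..\<delta>} t
            + ennreal (1 / c) * liminf (\<lambda>n. indicator {0..\<delta>} t * \<Phi> n t) \<partial>lborel)"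
  proof (rule nn_integral_mono_AE)
    have "AE t in lborel. t \<noteq> (0::real)" by (rule AE_lborel_singleton)
    then show "AE t in lborel. 1 / distribution_fun {a..b} w t * indicator {0..\<delta>} t
        \<le> ennreal (1 / d\<^sub>0) * indicator {0..\<delta>} t + ennreal (1 / c) * liminf (\<lambda>n. indicator {0..\<delta>} t * \<Phi> n t)"
      by eventually_elim (use pointwise in \<open>auto split: split_indicator\<close>)
  qed
  also have "\<dots> = ennreal (1 / d\<^sub>0) * ennreal \<delta>
      + ennreal (1 / c) * (\<integral>\<^sup>+t. liminf (\<lambda>n. indicator {0..\<delta>} t * \<Phi> n t) \<partial>lborel)"
    using \<delta> by (simp add: nn_integral_add nn_integral_cmult nn_integral_cmult_indicator)
  also have "\<dots> \<le> ennreal (1 / d\<^sub>0) * ennreal \<delta> + ennreal (1 / c) * C"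
  proof (intro add_left_mono mult_left_mono)
    have "(\<integral>\<^sup>+t. liminf (\<lambda>n. indicator {0..\<delta>} t * \<Phi> n t) \<partial>lborel)
        \<le> liminf (\<lambda>n. \<integral>\<^sup>+t. indicator {0..\<delta>} t * \<Phi> n t \<partial>lborel)"
      by (rule nn_integral_liminf) measurable
    also have "\<dots> \<le> liminf (\<lambda>n. C)"
      by (intro Liminf_mono always_eventually allI \<Phi>_bound)
    also have "\<dots> = C" by (simp add: Liminf_const)
    finally show "(\<integral>\<^sup>+t. liminf (\<lambda>n. indicator {0..\<delta>} t * \<Phi> n t) \<partial>lborel) \<le> C" .
  qed simp
  also have "\<dots> < \<infinity>" using C by (simp add: ennreal_mult_less_top less_top)
  finally show ?thesis .
qed

section \<open>Lebesgue decomposition\<close>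

lemma (in cauchy_integrable) emeasure_Icc_finite: "emeasure \<nu> {c..d} < \<infinity>"
proof -
  have "emeasure \<nu> {c..d} = (\<integral>\<^sup>+s. indicator {c..d} s \<partial>\<nu>)" by simp
  also have "\<dots> \<le> (\<integral>\<^sup>+s. ennreal ((d - c)\<^sup>2 + 1) * ennreal (1 / (cmod (of_real s - Complex c 1))\<^sup>2) \<partial>\<nu>)"
  proof (rule nn_integral_mono)
    fix s
    show "indicator {c..d} s \<le> ennreal ((d - c)\<^sup>2 + 1) * ennreal (1 / (cmod (of_real s - Complex c 1))\<^sup>2)"
    proof (cases "s \<in> {c..d}")
      case True
      have sq: "(cmod (of_real s - Complex c 1))\<^sup>2 = (s - c)\<^sup>2 + 1" by (simp add: cmod_power2)
      have "(s - c)\<^sup>2 + 1 \<le> (d - c)\<^sup>2 + 1" using True by (intro add_right_mono power_mono) auto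
      then have "1 \<le> ((d - c)\<^sup>2 + 1) * (1 / ((s - c)\<^sup>2 + 1))"
        by (simp add: le_divide_eq add_nonneg_pos)
      then have "ennreal 1 \<le> ennreal (((d - c)\<^sup>2 + 1) * (1 / ((s - c)\<^sup>2 + 1)))" by (rule ennreal_leI)
      then show ?thesis using True unfolding sq by (subst ennreal_mult[symmetric]) (auto simp del: times_divide_eq_right)
    qed simp
  qed
  also have "\<dots> = ennreal ((d - c)\<^sup>2 + 1) * (\<integral>\<^sup>+s. ennreal (1 / (cmod (of_real s - Complex c 1))\<^sup>2) \<partial>\<nu>)"
    by (rule nn_integral_cmult) simp
  also have "\<dots> < \<infinity>"
    using nn_integral_eq_integral[OF integrable_kernel_square[of "Complex c 1"]]
    by (simp add: ennreal_mult_less_top)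
  finally show ?thesis .
qed

lemma emeasure_sum_of_measures:
  fixes M N :: "'a measure"
  assumes "sets N = sets M" "A \<in> sets M"
  shows "emeasure (measure_of (space M) (sets M) (\<lambda>A. emeasure M A + emeasure N A)) A = emeasure M A + emeasure N A"
proof (rule emeasure_measure_of_sigma)
  show "sigma_algebra (space M) (sets M)" ..
  show "positive (sets M) (\<lambda>A. emeasure M A + emeasure N A)" by (simp add: positive_def)
  show "countably_additive (sets M) (\<lambda>A. emeasure M A + emeasure N A)"
  proof (rule countably_additiveI)
    fix A :: "nat \<Rightarrow> 'a set"
    assume A: "range A \<subseteq> sets M" "disjoint_family A"
    then show "(\<Sum>i. emeasure M (A i) + emeasure N (A i)) = emeasure M (\<Union>i. A i) + emeasure N (\<Union>i. A i)"
      using assms(1) by (simp add: suminf_add[symmetric] suminf_emeasure)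
  qed
qed (use assms in auto)

text \<open>
  Let \<open>f\<close> be the density of Lebesgue measure with respect to the sum \<open>P\<close> of Lebesgue measure and \<open>N\<close>.
  Its zero set \<open>Z\<close> is a Lebesgue null set; off \<open>Z\<close> a Lebesgue null set is \<open>P\<close>-null, so that \<open>N\<close> is
  absolutely continuous there.
\<close>

lemma lebesgue_decomposition_exists:
  fixes N :: "real measure"
  assumes sets_N [measurable_cong, simp]: "sets N = sets borel"
    and fin: "\<And>c d. emeasure N {c..d} < \<infinity>"
  shows "\<exists>w. \<exists>Z\<in>null_sets lborel. lebesgue_decomposition N w (density N (indicator Z))"
proof -
  have space_N [simp]: "space N = UNIV" using sets_eq_imp_space_eq[OF sets_N] by simp
  define P where "P = measure_of (space lborel) (sets lborel) (\<lambda>A. emeasure lborel A + emeasure N A)"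
  have P_sets [measurable_cong, simp]: "sets P = sets borel"
    unfolding P_def by (simp add: sets.sigma_sets_eq[of borel, simplified])
  have [simp]: "space P = UNIV" using sets_eq_imp_space_eq[OF P_sets] by simp
  have P: "emeasure P A = emeasure lborel A + emeasure N A" if "A \<in> sets borel" for A
    unfolding P_def by (rule emeasure_sum_of_measures) (use that in auto)
  have cover: "(\<Union>n. {- real n..real n}) = UNIV"
  proof (intro set_eqI iffI UNIV_I)
    fix x :: real
    obtain n where "\<bar>x\<bar> \<le> real n" using real_arch_simple by blast
    then show "x \<in> (\<Union>n. {- real n..real n})" by (intro UN_I[of n]) auto
  qed
  have sigma_finite: "sigma_finite_measure Q" if "sets Q = sets borel" "\<And>c d. emeasure Q {c..d} < \<infinity>" for Q :: "real measure"
  proof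
    show "\<exists>A. countable A \<and> A \<subseteq> sets Q \<and> \<Union> A = space Q \<and> (\<forall>a\<in>A. emeasure Q a \<noteq> \<infinity>)"
      using that(2) sets_eq_imp_space_eq[OF that(1)] cover
      by (intro exI[of _ "range (\<lambda>n. {- real n..real n})"]) (auto simp: that(1) less_top)
  qed
  interpret P: sigma_finite_measure P
    by (rule sigma_finite) (auto simp: P fin[simplified] emeasure_lborel_Icc_eq)
  have "absolutely_continuous P lborel"
    unfolding absolutely_continuous_def by (auto simp: null_sets_def P)
  then obtain f where f': "f \<in> borel_measurable P" and Pf: "density P f = lborel"
    using P.Radon_Nikodym[of lborel] by auto
  have f [measurable]: "f \<in> borel_measurable borel"
    using f' measurable_cong_sets[OF P_sets refl] by blast
  define Z where "Z = {x. f x = 0}"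
  have Z [measurable]: "Z \<in> sets borel" unfolding Z_def by measurable
  have "emeasure (density P f) Z = (\<integral>\<^sup>+x. f x * indicator Z x \<partial>P)"
    by (rule emeasure_density) auto
  also have "\<dots> = (\<integral>\<^sup>+x. 0 \<partial>P)" by (intro nn_integral_cong) (auto simp: Z_def indicator_def)
  finally have Z_null: "Z \<in> null_sets lborel" by (simp add: Pf null_sets_def)
  have N_null: "emeasure N (- Z \<inter> A) = 0" if A: "A \<in> null_sets lborel" for A
  proof -
    have [measurable]: "A \<in> sets borel" using A by auto
    have "(\<integral>\<^sup>+x. f x * indicator A x \<partial>P) = emeasure (density P f) A"
      by (rule emeasure_density[symmetric]) auto
    also have "\<dots> = 0" using A by (auto simp: Pf null_sets_def)
    finally have "AE x in P. f x * indicator A x = 0"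
      by (subst (asm) nn_integral_0_iff_AE) auto
    then have "AE x in P. x \<notin> - Z \<inter> A"
      by eventually_elim (auto simp: Z_def indicator_def)
    then have "emeasure P (- Z \<inter> A) = 0"
      by (subst (asm) AE_iff_measurable[of "- Z \<inter> A"]) auto
    then show ?thesis by (simp add: P)
  qed
  let ?ac = "density N (indicator (- Z))" and ?s = "density N (indicator Z)"
  have ac: "absolutely_continuous lborel ?ac"
    unfolding absolutely_continuous_def using N_null
    by (auto simp: null_sets_def emeasure_restricted)
  have ac_fin: "emeasure ?ac {c..d} < \<infinity>" for c d
    using le_less_trans[OF emeasure_mono fin, of "- Z \<inter> {c..d}" c d]
    by (simp add: emeasure_restricted)
  have sf: "sigma_finite_measure ?ac"
    by (rule sigma_finite) (use ac_fin in auto)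
  define w where "w x = enn2real (RN_deriv lborel ?ac x)" for x
  have w_eq: "AE x in lborel. RN_deriv lborel ?ac x = ennreal (w x)"
    using sigma_finite_measure.RN_deriv_finite[OF lborel.sigma_finite_measure_axioms sf ac] unfolding w_def
    by (auto simp: less_top elim: eventually_mono)
  have "lebesgue_decomposition N w ?s"
    unfolding lebesgue_decomposition_def
  proof (intro conjI allI ballI)
    show "w \<in> borel_measurable borel" unfolding w_def by measurable
    show "0 \<le> w x" for x by (simp add: w_def)
    show "\<exists>Z\<in>null_sets lborel. emeasure ?s (- Z) = 0"
      using Z_null by (intro bexI[of _ Z]) (auto simp: emeasure_restricted)
  next
    fix B :: "real set" assume B: "B \<in> sets borel"
    have "emeasure N B = emeasure N (- Z \<inter> B) + emeasure N (Z \<inter> B)"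
      using B by (subst plus_emeasure) (auto intro!: arg_cong[where f = "emeasure N"])
    also have "\<dots> = emeasure ?ac B + emeasure ?s B"
      using B by (simp add: emeasure_restricted)
    also have "emeasure ?ac B = emeasure (density lborel (RN_deriv lborel ?ac)) B"
      by (simp add: sigma_finite_measure.density_RN_deriv[OF lborel.sigma_finite_measure_axioms ac])
    also have "\<dots> = (\<integral>\<^sup>+x. RN_deriv lborel ?ac x * indicator B x \<partial>lborel)"
      using B by (simp add: emeasure_density)
    also have "\<dots> = (\<integral>\<^sup>+x\<in>B. ennreal (w x) \<partial>lborel)"
      by (rule nn_integral_cong_AE) (use w_eq in \<open>auto elim: eventually_mono\<close>)
    finally show "emeasure N B = (\<integral>\<^sup>+x\<in>B. ennreal (w x) \<partial>lborel) + emeasure ?s B" .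
  qed auto
  with Z_null show ?thesis by blast
qed

section \<open>Spectral measures of rank one perturbations\<close>

lemma cauchy_integrable_of_integrable_inverse:
  assumes sets: "sets \<mu> = sets borel" and int: "integrable \<mu> (\<lambda>t. 1 / (1 + \<bar>t\<bar>))"
  shows "cauchy_integrable \<mu>"
proof
  fix z :: complex assume z: "Im z > 0"
  note [measurable_cong] = sets
  define C where "C = 1 + (1 + cmod z) / Im z"
  have le: "cmod (1 / (of_real t - z)) \<le> C * (1 / (1 + \<bar>t\<bar>))" for t
  proof -
    let ?d = "cmod (of_real t - z)"
    have d: "Im z \<le> ?d" by (rule Im_le_cmod_of_real_diff)
    have "\<bar>t\<bar> \<le> ?d + cmod z" using norm_triangle_ineq[of "of_real t - z" z] by simp
    moreover have "1 + cmod z \<le> (1 + cmod z) / Im z * ?d"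
      using d z by (simp add: pos_le_divide_eq mult_left_mono)
    ultimately have "1 + \<bar>t\<bar> \<le> C * ?d" by (simp add: C_def algebra_simps)
    then have "(1 + \<bar>t\<bar>) / ?d \<le> C" using d z by (subst pos_divide_le_eq) auto
    then show ?thesis by (simp add: norm_divide pos_le_divide_eq)
  qed
  show "integrable \<mu> (\<lambda>s. 1 / (of_real s - z))"
  proof (rule Bochner_Integration.integrable_bound[OF integrable_mult_right[OF int, of C]])
    show "(\<lambda>s. 1 / (complex_of_real s - z)) \<in> borel_measurable \<mu>" by measurable
    show "AE t in \<mu>. cmod (1 / (of_real t - z)) \<le> norm (C * (1 / (1 + \<bar>t\<bar>)))"
      using order_trans[OF le abs_ge_self] by (intro AE_I2) (simp only: real_norm_def)
  qed
qed (rule sets)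

lemma is_spectral_measure_cauchy_integrable:
  "is_spectral_measure \<mu> \<alpha> \<nu> \<Longrightarrow> cauchy_integrable \<nu>"
  unfolding is_spectral_measure_def cauchy_integrable_def by (auto simp: has_bochner_integral_iff)

lemma borel_transform_spectral_measure:
  assumes \<mu>: "cauchy_integrable \<mu>" and \<nu>: "is_spectral_measure \<mu> \<alpha> \<nu>" and z: "Im z > 0"
  shows "borel_transform \<nu> z = borel_transform \<mu> z / (1 + of_real \<alpha> * borel_transform \<mu> z)"
proof -
  interpret cauchy_integrable \<mu> by fact
  let ?F = "borel_transform \<mu> z"
  let ?D = "1 + of_real \<alpha> * ?F"
  have nz: "?D \<noteq> 0" by (rule one_plus_borel_transform_nonzero[OF z])
  have "borel_transform \<nu> z = L2_inner \<mu> (rank_one_resolvent \<mu> \<alpha> z (\<lambda>_. 1)) (\<lambda>_. 1)"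
    using \<nu> z unfolding is_spectral_measure_def borel_transform_def[of \<nu>]
    by (intro has_bochner_integral_integral_eq) auto
  also have "\<dots> = (LINT t|\<mu>. 1 / (of_real t - z) - of_real \<alpha> * ?F / ?D * (1 / (of_real t - z)))"
    by (simp add: L2_inner_def rank_one_resolvent_def borel_transform_def)
  also have "\<dots> = (LINT t|\<mu>. 1 / (of_real t - z)) - (LINT t|\<mu>. of_real \<alpha> * ?F / ?D * (1 / (of_real t - z)))"
    by (intro Bochner_Integration.integral_diff integrable_mult_right integrable_kernel z)
  also have "\<dots> = ?F - of_real \<alpha> * ?F / ?D * ?F"
    by (simp only: Bochner_Integration.integral_mult_right_zero flip: borel_transform_def)
  also have "\<dots> = ?F / ?D" using nz by (simp add: field_simps)
  finally show ?thesis .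
qed

text \<open>
  The perturbation with parameter \<open>\<beta>\<close> is the perturbation of the one with parameter \<open>\<alpha>\<close> by \<open>\<beta> - \<alpha>\<close>.
\<close>

lemma borel_transform_change_of_coupling:
  assumes \<mu>: "cauchy_integrable \<mu>" and spec: "\<And>\<beta>. is_spectral_measure \<mu> \<beta> (M \<beta>)" and z: "Im z > 0"
  shows "borel_transform (M \<beta>) z = borel_transform (M \<alpha>) z / (1 + of_real (\<beta> - \<alpha>) * borel_transform (M \<alpha>) z)"
proof -
  interpret cauchy_integrable \<mu> by fact
  let ?F = "borel_transform \<mu> z"
  have nz: "1 + of_real \<alpha> * ?F \<noteq> 0" "1 + of_real \<beta> * ?F \<noteq> 0"
    by (rule one_plus_borel_transform_nonzero[OF z])+
  have "1 + of_real (\<beta> - \<alpha>) * (?F / (1 + of_real \<alpha> * ?F)) = (1 + of_real \<beta> * ?F) / (1 + of_real \<alpha> * ?F)"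
    using nz(1) by (simp add: field_simps)
  then show ?thesis
    using nz by (simp add: borel_transform_spectral_measure[OF \<mu> spec z])
qed

text \<open>
  The measure generated by a set function is that set function if it is countably additive, and zero
  otherwise; in both cases it does not exceed the set function.
\<close>

lemma averaged_measure_le: "emeasure (averaged_measure \<sigma> M) B \<le> (\<integral>\<^sup>+\<beta>. emeasure (M \<beta>) B \<partial>\<sigma>)"
  unfolding averaged_measure_def by (simp add: emeasure_measure_of_conv)

lemma (in cauchy_integrable) emeasure_Icc_le_Im_borel_transform:
  assumes y: "0 < y"
  shows "emeasure \<nu> {x..x + y} \<le> ennreal (2 * y) * ennreal (Im (borel_transform \<nu> (Complex x y)))"
proof -
  have "emeasure \<nu> {x..x + y} = (\<integral>\<^sup>+s. indicator {x..x + y} s \<partial>\<nu>)" by simp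
  also have "\<dots> \<le> (\<integral>\<^sup>+s. ennreal (2 * y) * ennreal (y / ((s - x)\<^sup>2 + y\<^sup>2)) \<partial>\<nu>)"
  proof (rule nn_integral_mono)
    fix s
    show "indicator {x..x + y} s \<le> ennreal (2 * y) * ennreal (y / ((s - x)\<^sup>2 + y\<^sup>2))"
    proof (cases "s \<in> {x..x + y}")
      case True
      then have "(s - x)\<^sup>2 \<le> y\<^sup>2" by (intro power_mono) auto
      then have "1 \<le> 2 * y * (y / ((s - x)\<^sup>2 + y\<^sup>2))"
        using y by (simp add: le_divide_eq add_nonneg_pos power2_eq_square)
      then have "ennreal 1 \<le> ennreal (2 * y * (y / ((s - x)\<^sup>2 + y\<^sup>2)))" by (rule ennreal_leI)
      also have "\<dots> = ennreal (2 * y) * ennreal (y / ((s - x)\<^sup>2 + y\<^sup>2))"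
        by (rule ennreal_mult) (use y in auto)
      finally show ?thesis using True by simp
    qed simp
  qed
  also have "\<dots> = ennreal (2 * y) * ennreal (Im (borel_transform \<nu> (Complex x y)))"
    using y by (simp add: Im_borel_transform_ennreal cmod_power2 nn_integral_cmult)
  finally show ?thesis .
qed

text \<open>
  A point outside the support has positive distance from almost every \<open>\<beta>\<close>.
\<close>

lemma closed_support_compl_subset_finite_energy_set:
  assumes sets: "sets \<sigma> = sets borel" and fin: "finite_measure \<sigma>"
  shows "- closed_support \<sigma> \<subseteq> finite_energy_set \<sigma>"
proof
  interpret finite_measure \<sigma> by fact
  fix x assume "x \<in> - closed_support \<sigma>"
  then obtain U where U: "open U" "x \<in> U" "emeasure \<sigma> U = 0" by (auto simp: closed_support_def)
  then obtain r where r: "0 < r" "ball x r \<subseteq> U" using openE by blast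
  have "AE \<beta> in \<sigma>. \<beta> \<notin> U"
    using U sets by (intro AE_not_in) (auto simp: null_sets_def)
  then have "(\<integral>\<^sup>+\<beta>. 1 / ennreal (\<bar>x - \<beta>\<bar>\<^sup>2) \<partial>\<sigma>) \<le> (\<integral>\<^sup>+\<beta>. ennreal (1 / r\<^sup>2) \<partial>\<sigma>)"
  proof (intro nn_integral_mono_AE, eventually_elim)
    case (elim \<beta>)
    then have \<beta>: "r \<le> \<bar>x - \<beta>\<bar>" using r by (auto simp: dist_real_def subset_iff not_less[symmetric])
    then have "0 < \<bar>x - \<beta>\<bar>\<^sup>2" "r\<^sup>2 \<le> \<bar>x - \<beta>\<bar>\<^sup>2" using r power_mono[OF \<beta>, of 2] by auto
    then show ?case using r by (auto simp: divide_ennreal frac_le simp flip: ennreal_1 intro!: ennreal_leI)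
  qed
  also have "\<dots> < \<infinity>" by (simp add: emeasure_eq_measure ennreal_mult[symmetric] less_top[symmetric] ennreal_mult_eq_top_iff)
  finally show "x \<in> finite_energy_set \<sigma>" by (simp add: finite_energy_set_def)
qed

text \<open>
  The functions of \<open>distribution_integral_finite\<close> are \<open>\<bar>g\<bar>\<^sup>2\<close> and \<open>4 H\<^sub>n\<close> on the line at height
  \<open>y\<^sub>n \<rightarrow> 0\<close>, where \<open>H\<^sub>n(x)\<close> is the average of \<open>Im F\<^sub>\<beta>(x + i y\<^sub>n)\<close> over \<open>\<beta>\<close>. Since \<open>2 y\<^sub>n H\<^sub>n(x)\<close> bounds
  the averaged measure of \<open>[x, x + y\<^sub>n]\<close>, the number \<open>2 H\<^sub>n(x)\<close> eventually exceeds \<open>t / 2\<close>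
  whenever \<open>0 < t \<le> min (w x) \<delta>\<close>, for almost every \<open>x\<close>; this is where the factor 4 comes from.
\<close>

lemma distribution_integral_finite_of_blowup:
  fixes \<mu> \<sigma> \<tau>\<^sub>s :: "real measure" and M :: "real \<Rightarrow> real measure" and w :: "real \<Rightarrow> real"
    and a b \<delta> \<alpha> :: real
  assumes \<mu>: "cauchy_integrable \<mu>" and spec: "\<And>\<beta>. is_spectral_measure \<mu> \<beta> (M \<beta>)"
    and sets_\<sigma> [measurable_cong]: "sets \<sigma> = sets borel" and fin_\<sigma>: "finite_measure \<sigma>"
    and dec: "lebesgue_decomposition (averaged_measure \<sigma> M) w \<tau>\<^sub>s"
    and ab: "a < b" and \<delta>: "0 < \<delta>" and \<alpha>: "\<alpha> \<in> finite_energy_set \<sigma>"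
    and K: "K \<in> sets borel" "emeasure (M \<alpha>) K < \<infinity>"
    and blowup: "energy_blowup a b (borel_transform (density (M \<alpha>) (indicator K)))"
  shows "(\<integral>\<^sup>+ y\<in>{0..\<delta>}. 1 / distribution_fun {a..b} w y \<partial>lborel) < \<infinity>"
proof -
  have spec_ci: "cauchy_integrable (M \<beta>)" for \<beta>
    using spec by (rule is_spectral_measure_cauchy_integrable)
  interpret N: cauchy_integrable "M \<alpha>" by (rule spec_ci)
  let ?\<nu> = "density (M \<alpha>) (indicator K)"
  interpret \<nu>: finite_cauchy_integrable ?\<nu> by (rule N.finite_cauchy_integrable_restriction[OF K])
  interpret \<sigma>: finite_measure \<sigma> by fact
  interpret pair_sigma_finite lborel \<sigma> ..
  let ?G = "borel_transform (M \<alpha>)" and ?g = "borel_transform ?\<nu>"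
  define p where "p \<beta> z = Im (?G z / (1 + of_real (\<beta> - \<alpha>) * ?G z))" for \<beta> z
  have p_eq: "p \<beta> z = Im (borel_transform (M \<beta>) z)" if "Im z > 0" for \<beta> z
    by (simp only: p_def borel_transform_change_of_coupling[OF \<mu> spec that, of \<beta> \<alpha>])
  have p_nonneg: "0 \<le> p \<beta> z" if "Im z > 0" for \<beta> z
    unfolding p_eq[OF that] by (rule cauchy_integrable.Im_borel_transform_nonneg[OF spec_ci that])
  define y where "y n = inverse (real (Suc n))" for n
  have y_pos: "0 < y n" for n by (simp add: y_def)
  have y_lim: "y \<longlonglongrightarrow> 0" unfolding y_def by (rule LIMSEQ_inverse_real_of_nat)
  have [measurable]: "(\<lambda>x. ?G (Complex x (y n))) \<in> borel_measurable borel"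
      "(\<lambda>x. ?g (Complex x (y n))) \<in> borel_measurable borel" for n
    by (intro borel_measurable_continuous_onI
        continuous_on_horizontal_line[OF N.holomorphic_borel_transform y_pos]
        continuous_on_horizontal_line[OF \<nu>.holomorphic_borel_transform y_pos])+
  have p_meas [measurable]: "(\<lambda>q. p (snd q) (Complex (fst q) (y n))) \<in> borel_measurable (borel \<Otimes>\<^sub>M borel)" for n
    unfolding p_def by measurable
  define H where "H n x = (\<integral>\<^sup>+\<beta>. ennreal (p \<beta> (Complex x (y n))) \<partial>\<sigma>)" for n x
  have H_meas [measurable]: "H n \<in> borel_measurable borel" for n
    unfolding H_def by (rule \<sigma>.borel_measurable_nn_integral) (simp add: case_prod_beta)
  have energy: "(\<integral>\<^sup>+\<beta>. 1 / ennreal (\<bar>\<alpha> - \<beta>\<bar>\<^sup>2) \<partial>\<sigma>) < \<infinity>"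
    using \<alpha> by (simp add: finite_energy_set_def)
  have ne_\<alpha>: "AE \<beta> in \<sigma>. \<beta> \<noteq> \<alpha>"
  proof -
    have "AE \<beta> in \<sigma>. 1 / ennreal (\<bar>\<alpha> - \<beta>\<bar>\<^sup>2) \<noteq> \<infinity>"
      by (rule nn_integral_noteq_infinite) (use energy in auto)
    then show ?thesis by eventually_elim auto
  qed
  define C where "C = 4 * (b - a + 4) * (b - a + 3)\<^sup>2 * measure ?\<nu> UNIV"
  have C: "0 \<le> C" using ab by (simp add: C_def)
  let ?bound = "4 * (ennreal C * (\<integral>\<^sup>+\<beta>. 1 / ennreal (\<bar>\<alpha> - \<beta>\<bar>\<^sup>2) \<partial>\<sigma>))"
  obtain c d\<^sub>0 where c: "0 < c" "0 < d\<^sub>0" and blow: "\<And>d. 0 < d \<and> d \<le> d\<^sub>0 \<longrightarrow>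
     (\<exists>y\<^sub>0>0. \<forall>y. 0 < y \<and> y < y\<^sub>0 \<longrightarrow>
       (\<forall>B\<in>sets borel. emeasure lborel B \<le> ennreal d \<longrightarrow>
          ennreal (c / d) \<le> (\<integral>\<^sup>+x\<in>{a..b} - B. ennreal ((cmod (?g (Complex x y)))\<^sup>2) \<partial>lborel)))"
    using blowup unfolding energy_blowup_def by blast
  have w [measurable]: "w \<in> borel_measurable borel" and w_nonneg: "\<And>x. 0 \<le> w x"
    using dec unfolding lebesgue_decomposition_def by auto
  have w_le: "(\<integral>\<^sup>+x\<in>B. ennreal (w x) \<partial>lborel) \<le> emeasure (averaged_measure \<sigma> M) B" if "B \<in> sets borel" for B
    using dec that unfolding lebesgue_decomposition_def by (simp add: add_increasing2)
  show ?thesis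
  proof (rule distribution_integral_finite[where h = "\<lambda>n x. 4 * H n x" and C = ?bound
        and g = "\<lambda>n x. ennreal ((cmod (?g (Complex x (y n))))\<^sup>2)", OF _ _ w c \<delta>])
    fix t assume t: "0 < t" "t \<le> \<delta>"
    \<comment> \<open>Only levels up to \<open>\<delta>\<close> matter, and the truncated density is bounded.\<close>
    let ?u = "\<lambda>x. min (w x) \<delta>"
    have u_meas: "?u \<in> borel_measurable borel" by measurable
    have u_bdd: "\<bar>?u x\<bar> \<le> \<delta>" for x using w_nonneg[of x] \<delta> by auto
    show "AE x in lborel. x \<in> {a..b} \<longrightarrow> t \<le> w x \<longrightarrow> (\<forall>\<^sub>F n in sequentially. ennreal t < 4 * H n x)"
      using lebesgue_differentiation_AE[OF u_meas u_bdd]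
    proof (eventually_elim, intro impI)
      fix x
      assume diff: "\<forall>e>0. \<exists>d>0. \<forall>h. 0 < h \<and> h < d \<longrightarrow> \<bar>integral {x..x + h} ?u / h - ?u x\<bar> < e"
        and tw: "t \<le> w x"
      then obtain d where d: "0 < d" "\<And>h. 0 < h \<Longrightarrow> h < d \<Longrightarrow> \<bar>integral {x..x + h} ?u / h - ?u x\<bar> < t / 2"
        using t by (metis half_gt_zero)
      have "\<forall>\<^sub>F n in sequentially. y n < d" by (rule order_tendstoD(2)[OF y_lim d(1)])
      then show "\<forall>\<^sub>F n in sequentially. ennreal t < 4 * H n x"
      proof eventually_elim
        case (elim n)
        let ?J = "{x..x + y n}"
        have "t / 2 < integral ?J ?u / y n" using d(2)[OF y_pos elim] tw t by linarith
        then have avg: "t / 2 * y n < integral ?J ?u" using y_pos[of n] by (simp add: pos_less_divide_eq)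
        have "ennreal (integral ?J ?u) = (\<integral>\<^sup>+x\<in>?J. ennreal (?u x) \<partial>lborel)"
          by (rule nn_integral_Icc_eq_integral[symmetric, OF bounded_set_integrable_Icc[OF u_meas u_bdd]])
            (use w_nonneg \<delta> in auto)
        also have "\<dots> \<le> (\<integral>\<^sup>+x\<in>?J. ennreal (w x) \<partial>lborel)"
          by (intro nn_integral_mono mult_right_mono ennreal_leI) auto
        also have "\<dots> \<le> emeasure (averaged_measure \<sigma> M) ?J" by (rule w_le) simp
        also have "\<dots> \<le> (\<integral>\<^sup>+\<beta>. emeasure (M \<beta>) ?J \<partial>\<sigma>)" by (rule averaged_measure_le)
        also have "\<dots> \<le> (\<integral>\<^sup>+\<beta>. ennreal (2 * y n) * ennreal (p \<beta> (Complex x (y n))) \<partial>\<sigma>)"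
        proof (rule nn_integral_mono)
          fix \<beta>
          show "emeasure (M \<beta>) ?J \<le> ennreal (2 * y n) * ennreal (p \<beta> (Complex x (y n)))"
            using cauchy_integrable.emeasure_Icc_le_Im_borel_transform[OF spec_ci y_pos, of \<beta> x n] y_pos[of n]
            by (simp add: p_eq)
        qed
        also have "\<dots> = ennreal (2 * y n) * H n x"
          unfolding H_def by (rule nn_integral_cmult) (simp add: p_def)
        finally have le: "ennreal (integral ?J ?u) \<le> ennreal (2 * y n) * H n x" .
        show ?case
        proof (cases "H n x")
          case (real r)
          then have "ennreal (integral ?J ?u) \<le> ennreal (2 * y n * r)"
            using le y_pos[of n] by (simp add: ennreal_mult)
          then have "integral ?J ?u \<le> 2 * y n * r"
            using real y_pos[of n] by (subst (asm) ennreal_le_iff) auto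
          then have "t / 2 * y n < 2 * r * y n" using avg by (simp add: mult_ac)
          then have "t < 4 * r" using y_pos[of n] by simp
          then have "ennreal t < ennreal (4 * r)" using t by (simp add: ennreal_lessI)
          also have "\<dots> = 4 * H n x" using real by (simp add: ennreal_mult)
          finally show ?thesis .
        next
          case top
          then show ?thesis by (simp add: ennreal_mult_top)
        qed
      qed
    qed
  next
    fix d assume d: "0 < d" "d \<le> d\<^sub>0"
    then obtain y\<^sub>0 where y0: "0 < y\<^sub>0" "\<And>y B. 0 < y \<Longrightarrow> y < y\<^sub>0 \<Longrightarrow> B \<in> sets borel \<Longrightarrow> emeasure lborel B \<le> ennreal d \<Longrightarrow>
          ennreal (c / d) \<le> (\<integral>\<^sup>+x\<in>{a..b} - B. ennreal ((cmod (?g (Complex x y)))\<^sup>2) \<partial>lborel)"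
      using blow[of d] by blast
    have "\<forall>\<^sub>F n in sequentially. y n < y\<^sub>0" by (rule order_tendstoD(2)[OF y_lim y0(1)])
    then show "\<forall>\<^sub>F n in sequentially. \<forall>B\<in>sets borel. emeasure lborel B \<le> ennreal d \<longrightarrow>
        ennreal (c / d) \<le> (\<integral>\<^sup>+x\<in>{a..b} - B. ennreal ((cmod (?g (Complex x (y n))))\<^sup>2) \<partial>lborel)"
      by eventually_elim (intro ballI impI y0 y_pos)
  next
    fix n
    let ?f = "\<lambda>x \<beta>. 4 * (ennreal ((cmod (?g (Complex x (y n))))\<^sup>2 * p \<beta> (Complex x (y n))) * indicator {a..b} x)"
    have "(\<integral>\<^sup>+x\<in>{a..b}. ennreal ((cmod (?g (Complex x (y n))))\<^sup>2) * (4 * H n x) \<partial>lborel)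
        = (\<integral>\<^sup>+x. (\<integral>\<^sup>+\<beta>. ?f x \<beta> \<partial>\<sigma>) \<partial>lborel)"
    proof (rule nn_integral_cong)
      fix x
      have "(\<integral>\<^sup>+\<beta>. ?f x \<beta> \<partial>\<sigma>) = (\<integral>\<^sup>+\<beta>. (4 * ennreal ((cmod (?g (Complex x (y n))))\<^sup>2) * indicator {a..b} x)
          * ennreal (p \<beta> (Complex x (y n))) \<partial>\<sigma>)"
        using p_nonneg y_pos by (intro nn_integral_cong) (simp add: ennreal_mult mult_ac)
      also have "\<dots> = (4 * ennreal ((cmod (?g (Complex x (y n))))\<^sup>2) * indicator {a..b} x) * H n x"
        unfolding H_def by (rule nn_integral_cmult) (simp add: p_def)
      finally show "ennreal ((cmod (?g (Complex x (y n))))\<^sup>2) * (4 * H n x) * indicator {a..b} x = (\<integral>\<^sup>+\<beta>. ?f x \<beta> \<partial>\<sigma>)"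
        by (simp add: mult_ac)
    qed
    also have "\<dots> = (\<integral>\<^sup>+\<beta>. (\<integral>\<^sup>+x. ?f x \<beta> \<partial>lborel) \<partial>\<sigma>)"
      by (rule Fubini'[symmetric]) (simp add: case_prod_beta)
    also have "\<dots> \<le> (\<integral>\<^sup>+\<beta>. 4 * (ennreal C * (1 / ennreal (\<bar>\<alpha> - \<beta>\<bar>\<^sup>2))) \<partial>\<sigma>)"
    proof (rule nn_integral_mono_AE)
      show "AE \<beta> in \<sigma>. (\<integral>\<^sup>+x. ?f x \<beta> \<partial>lborel) \<le> 4 * (ennreal C * (1 / ennreal (\<bar>\<alpha> - \<beta>\<bar>\<^sup>2)))"
        using ne_\<alpha>
      proof eventually_elim
        case (elim \<beta>)
        have "(\<integral>\<^sup>+x. ?f x \<beta> \<partial>lborel)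
            = 4 * (\<integral>\<^sup>+x\<in>{a..b}. ennreal ((cmod (?g (Complex x (y n))))\<^sup>2 * p \<beta> (Complex x (y n))) \<partial>lborel)"
          by (rule nn_integral_cmult) (simp add: p_def)
        also have "\<dots> \<le> 4 * ennreal (C / (\<beta> - \<alpha>)\<^sup>2)"
          unfolding p_def C_def
          by (intro mult_left_mono perturbation_energy_integral_le[OF spec_ci \<nu>.finite_cauchy_integrable_axioms])
            (use elim y_pos ab N.Im_borel_transform_restriction_le[OF K] in auto)
        also have "ennreal (C / (\<beta> - \<alpha>)\<^sup>2) = ennreal C * (1 / ennreal (\<bar>\<alpha> - \<beta>\<bar>\<^sup>2))"
        proof -
          have "1 / ennreal (\<bar>\<alpha> - \<beta>\<bar>\<^sup>2) = ennreal (1 / (\<beta> - \<alpha>)\<^sup>2)"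
            using elim by (simp add: divide_ennreal power2_commute flip: ennreal_1)
          then show ?thesis using C by (simp add: ennreal_mult[symmetric])
        qed
        finally show ?case .
      qed
    qed
    also have "\<dots> = ?bound" by (simp add: nn_integral_cmult)
    finally show "(\<integral>\<^sup>+x\<in>{a..b}. ennreal ((cmod (?g (Complex x (y n))))\<^sup>2) * (4 * H n x) \<partial>lborel) \<le> ?bound" .
  next
    show "?bound < \<infinity>" using energy by (simp add: ennreal_mult_less_top)
  qed measurable
qed

theorem theorem4p7:
  fixes \<mu> \<sigma> \<tau>\<^sub>s :: "real measure"
    and M :: "real \<Rightarrow> real measure"
    and w :: "real \<Rightarrow> real"
    and a b \<delta> :: real
  assumes "sets \<mu> = sets borel"
    and "integrable \<mu> (\<lambda>t. 1 / (1 + \<bar>t\<bar>))"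
    and "\<And>\<beta>. is_spectral_measure \<mu> \<beta> (M \<beta>)"
    and "sets \<sigma> = sets borel"
    and "finite_measure \<sigma>"
    and "lebesgue_decomposition (averaged_measure \<sigma> M) w \<tau>\<^sub>s"
    and "a < b"
    and "0 < \<delta>"
    and "(\<integral>\<^sup>+ y\<in>{0..\<delta>}. 1 / distribution_fun {a..b} w y \<partial>lborel) = \<infinity>"
  shows "(\<forall>\<alpha>\<in>finite_energy_set \<sigma>. empty_singular_spectrum_on (M \<alpha>) {a..b}) \<and>
         - closed_support \<sigma> \<subseteq> finite_energy_set \<sigma>"
proof (intro conjI ballI closed_support_compl_subset_finite_energy_set[OF assms(4,5)])
  fix \<alpha> assume \<alpha>: "\<alpha> \<in> finite_energy_set \<sigma>"
  let ?N = "M \<alpha>"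
  interpret N: cauchy_integrable ?N
    using assms(3) by (rule is_spectral_measure_cauchy_integrable)
  have no_blowup: "\<not> energy_blowup a b (borel_transform (density ?N (indicator K)))"
    if K: "K \<in> sets borel" "emeasure ?N K < \<infinity>" for K
    using distribution_integral_finite_of_blowup[OF cauchy_integrable_of_integrable_inverse[OF assms(1,2)]
        assms(3-8) \<alpha> K] assms(9) by auto
  \<comment> \<open>The end points of the interval are treated separately, as possible atoms.\<close>
  have null: "emeasure ?N K = 0" if K: "compact K" "K \<subseteq> {a..b}" "K \<in> null_sets lborel"
      and place: "K \<subseteq> {a<..<b} \<or> (\<exists>e. K = {e})" for K
  proof (rule ccontr)
    assume nz: "emeasure ?N K \<noteq> 0"
    have K_borel: "K \<in> sets borel" using K(3) by auto
    have fin: "emeasure ?N K < \<infinity>"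
      using K(2) by (intro le_less_trans[OF emeasure_mono N.emeasure_Icc_finite]) auto
    let ?\<nu> = "density ?N (indicator K)"
    have \<nu>: "finite_cauchy_integrable ?\<nu>"
      by (rule N.finite_cauchy_integrable_restriction[OF K_borel fin])
    have conc: "AE s in ?\<nu>. s \<in> K"
      using K_borel by (subst AE_density) (auto simp: indicator_def)
    have "measure ?\<nu> UNIV = measure ?N K"
      using K_borel by (simp add: measure_def emeasure_restricted)
    then have pos: "0 < measure ?\<nu> UNIV"
      using nz fin by (simp add: measure_def enn2real_positive_iff less_top zero_less_iff_neq_zero)
    from place have "energy_blowup a b (borel_transform ?\<nu>)"
    proof (elim disjE exE)
      assume "K \<subseteq> {a<..<b}"
      then show ?thesis by (rule energy_blowup_interior[OF \<nu> K(1) _ K(3) conc pos])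
    next
      fix e assume "K = {e}"
      then show ?thesis using energy_blowup_atom[OF \<nu> _ assms(7) _ pos, of e] conc K(2) by simp
    qed
    with no_blowup[OF K_borel fin] show False by simp
  qed
  obtain v Z where Z: "Z \<in> null_sets lborel" and dec: "lebesgue_decomposition ?N v (density ?N (indicator Z))"
    using lebesgue_decomposition_exists[OF N.sets_eq_borel N.emeasure_Icc_finite] by blast
  have Z_borel [measurable]: "Z \<in> sets borel" using Z by auto
  have interior: "emeasure ?N (Z \<inter> {a<..<b}) = 0"
  proof -
    let ?\<kappa> = "density ?N (indicator {a<..<b})"
    have \<kappa>: "emeasure ?\<kappa> B = emeasure ?N ({a<..<b} \<inter> B)" if "B \<in> sets borel" for B
      using that by (simp add: emeasure_restricted)
    have "emeasure ?\<kappa> (space ?\<kappa>) < \<infinity>"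
      by (simp add: \<kappa>, rule le_less_trans[OF emeasure_mono N.emeasure_Icc_finite[of a b, simplified]]) auto
    then have "emeasure ?\<kappa> (Z \<inter> {a<..<b}) = (SUP K\<in>{K. K \<subseteq> Z \<inter> {a<..<b} \<and> compact K}. emeasure ?\<kappa> K)"
      by (intro inner_regular) auto
    also have "\<dots> \<le> 0"
    proof (rule SUP_least)
      fix K assume K: "K \<in> {K. K \<subseteq> Z \<inter> {a<..<b} \<and> compact K}"
      then have K_borel: "K \<in> sets borel" by (auto intro: borel_compact)
      have "K \<in> null_sets lborel" by (rule null_sets_subset[OF Z]) (use K K_borel in auto)
      then have "emeasure ?N K = 0" by (intro null) (use K in auto)
      moreover have "{a<..<b} \<inter> K = K" using K by auto
      ultimately show "emeasure ?\<kappa> K \<le> 0" using \<kappa>[OF K_borel] by simp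
    qed
    finally show ?thesis using \<kappa>[of "Z \<inter> {a<..<b}"] by (simp add: Int_commute Int_left_commute)
  qed
  have "emeasure (density ?N (indicator Z)) {a..b} = emeasure ?N (Z \<inter> {a..b})"
    by (simp add: emeasure_restricted)
  also have "\<dots> \<le> emeasure ?N (Z \<inter> {a<..<b} \<union> ({a} \<union> {b}))"
    by (rule emeasure_mono) auto
  also have "\<dots> \<le> emeasure ?N (Z \<inter> {a<..<b}) + (emeasure ?N {a} + emeasure ?N {b})"
    by (intro order_trans[OF emeasure_subadditive] add_left_mono emeasure_subadditive) auto
  also have "\<dots> = 0"
    using interior null[of "{a}"] null[of "{b}"] assms(7) by (simp add: null_sets_def)
  finally show "empty_singular_spectrum_on ?N {a..b}"
    unfolding empty_singular_spectrum_on_def using dec by (intro exI conjI) auto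
qed

end
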